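(* Let $\theta$ be an injective primitive, length $r$ substitution of height one, and such that $(X_\theta,\sigma)$ is infinite. Let $c$ be the column number of $\theta$. If $\Phi\in\mathrm{Aut}(X_\theta,\sigma)$ has the property that $\kappa(\Phi)\in\mathbb Z_r\setminus\mathbb Z$ is periodic, then $\Phi$ has right radius zero and left radius at most $1$. Further, if $\kappa(\Phi)=k/(1-r^p)$ for integers $p\ge 1$ and $0<k<r^p-1$, one has $$\theta^{-c!p}\circ\sigma^{-k(1+r^p+r^{2p}+\cdots+r^{(c!-1)p})}\circ\Phi\circ\theta^{c!p}=\Phi .$$ If $\kappa(\Phi)=0$, then $\Phi$ has left and right radius at most $1$ and $\Phi$ satisfies $\theta^{-c!}\circ\Phi\circ\theta^{c!}=\Phi$.
   Context: $\mathcal A$ is a finite alphabet. A substitution of length $r$ is a map $\theta:\mathcal A\to\mathcal A^r$, extended by concatenation to finite words and to bi-infinite sequences ($\theta(x_0)$ occupying coordinates $0,\ldots,r-1$); write $\theta(a)=\theta_0(a)\cdots\theta_{r-1}(a)$, so each $\theta_i:\mathcal A\to\mathcal A$. $\theta$ is injective if $\theta(a)\ne\theta(b)$ for distinct letters $a,b$; primitive if for some $k$, every letter occurs in $\theta^k(a)$ for every letter $a$. $X_\theta\subset\mathcal A^{\mathbb Z}$ is the two-sided shift of all bi-infinite sequences all of whose finite subwords occur in a one-sided $\theta$-periodic point, with shift map $\sigma$; $\mathrm{Aut}(X_\theta,\sigma)$ is the group of self-homeomorphisms of $X_\theta$ commuting with $\sigma$. Recognizability gives that $\theta^n:X_\theta\to\theta^n(X_\theta)$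 is invertible; $\theta^{-n}$ denotes its inverse. Height: with $u=u_0u_1\ldots$ a fixed point of $\theta$ (or of a power of $\theta$), $h(\theta)=\max\{n\ge1:\gcd(n,r)=1,\ n\mid\gcd\{a:u_a=u_0\}\}$. The column number of a height-one $\theta$ is $c=\min|\theta_{i_1}\circ\cdots\circ\theta_{i_k}(\mathcal A)|$ over all $k\ge1$ and $i_1,\ldots,i_k\in\{0,\ldots,r-1\}$. $\mathbb Z_r$ is the additive group of $r$-adic integers ($r$ not necessarily prime), written as left-infinite digit sequences $\ldots x_2x_1x_0$ over $\{0,\ldots,r-1\}$; an element is periodic if its digit sequence $(x_n)_{n\ge0}$ is periodic. $\mathbb Z\subset\mathbb Z_r$ in the usual way. The maximal equicontinuous factor of $(X_\theta,\sigma)$ is $(\mathbb Z_r,+1)$, with factor map $\pi:X_\theta\to\mathbb Z_r$ determined as follows: for each $n$, $\pi(x)\equiv i\pmod{r^n}$, $0\le i<r^n$, iff $x\in\sigma^i(\theta^n(X_\theta))$. For $\Phi\in\mathrm{Aut}(X_\theta,\sigma)$, $\kappa(\Phi)\in\mathbb Z_r$ is the unique element with $\pi(\Phi(x))=\kappa(\Phi)+\pi(x)$ for all $x$. Radii: $\Phi$ is given by $\Phi(x)_n=f(x_{n-l},\ldots,x_{n+m})$ for all $x,n$, for some $l,m\ge 0$ and $f:\mathcal A^{l+m+1}\to\mathcal A$; the smallest possible $l$ and $m$ are the left and right radius of $\Phi$ respectively. *)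

theory Defs
  imports "HOL-Analysis.Analysis"
begin

section \<open>Substitutions of constant length\<close>

text \<open>
  The alphabet is a type of class \<^class>\<open>finite\<close>. A substitution of length \<open>r\<close> is a map
  \<open>\<theta> :: 'a \<Rightarrow> 'a list\<close> all of whose values have length \<open>r\<close>; the column map \<open>\<theta>\<^sub>i\<close> is
  \<open>\<lambda>a. \<theta> a ! i\<close> for \<open>i < r\<close>.
\<close>

definition substitution :: "nat \<Rightarrow> ('a::finite \<Rightarrow> 'a list) \<Rightarrow> bool" where
  "substitution r \<theta> \<longleftrightarrow> (\<forall>a. length (\<theta> a) = r)"

definition subst_word :: "('a \<Rightarrow> 'a list) \<Rightarrow> 'a list \<Rightarrow> 'a list" where
  "subst_word \<theta> w = concat (map \<theta> w)"

definition subst_one :: "nat \<Rightarrow> ('a \<Rightarrow> 'a list) \<Rightarrow> (nat \<Rightarrow> 'a) \<Rightarrow> nat \<Rightarrow> 'a" where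
  "subst_one r \<theta> u = (\<lambda>j. \<theta> (u (j div r)) ! (j mod r))"

definition subst_bi :: "nat \<Rightarrow> ('a \<Rightarrow> 'a list) \<Rightarrow> (int \<Rightarrow> 'a) \<Rightarrow> int \<Rightarrow> 'a" where
  "subst_bi r \<theta> x = (\<lambda>j. \<theta> (x (j div int r)) ! nat (j mod int r))"

definition primitive_subst :: "('a::finite \<Rightarrow> 'a list) \<Rightarrow> bool" where
  "primitive_subst \<theta> \<longleftrightarrow> (\<exists>k\<ge>1. \<forall>a b. b \<in> set ((subst_word \<theta> ^^ k) [a]))"

definition periodic_point :: "nat \<Rightarrow> ('a \<Rightarrow> 'a list) \<Rightarrow> (nat \<Rightarrow> 'a) \<Rightarrow> bool" where
  "periodic_point r \<theta> u \<longleftrightarrow> (\<exists>n\<ge>1. (subst_one r \<theta> ^^ n) u = u)"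

text \<open>The value of \<open>height\<close> does not depend on the chosen periodic point when \<open>\<theta>\<close> is primitive.
  Then \<open>u 0\<close> recurs in \<open>u\<close>, so the gcd is positive and the maximum is over a finite set.\<close>

definition height :: "nat \<Rightarrow> ('a \<Rightarrow> 'a list) \<Rightarrow> nat" where
  "height r \<theta> = (let u = (SOME u. periodic_point r \<theta> u)
     in Max {n. n \<ge> 1 \<and> coprime n r \<and> n dvd Gcd {a. u a = u 0}})"

definition column_comp :: "('a \<Rightarrow> 'a list) \<Rightarrow> nat list \<Rightarrow> 'a \<Rightarrow> 'a" where
  "column_comp \<theta> ks = foldr (\<lambda>i g. (\<lambda>a. \<theta> a ! i) \<circ> g) ks id"

definition column_number :: "nat \<Rightarrow> ('a::finite \<Rightarrow> 'a list) \<Rightarrow> nat" where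
  "column_number r \<theta> = Min {card (range (column_comp \<theta> ks)) | ks. ks \<noteq> [] \<and> set ks \<subseteq> {..<r}}"


section \<open>The two-sided substitution shift and its automorphisms\<close>

definition shift_pow :: "int \<Rightarrow> (int \<Rightarrow> 'a) \<Rightarrow> int \<Rightarrow> 'a" where
  "shift_pow m x = (\<lambda>n. x (n + m))"

abbreviation shift :: "(int \<Rightarrow> 'a) \<Rightarrow> int \<Rightarrow> 'a" where
  "shift \<equiv> shift_pow 1"

definition subst_shift :: "nat \<Rightarrow> ('a \<Rightarrow> 'a list) \<Rightarrow> (int \<Rightarrow> 'a) set" where
  "subst_shift r \<theta> = {x. \<exists>u. periodic_point r \<theta> u \<and>
     (\<forall>i n. \<exists>j. \<forall>t<n. x (i + int t) = u (j + t))}"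

definition subst_shift_top :: "nat \<Rightarrow> ('a \<Rightarrow> 'a list) \<Rightarrow> (int \<Rightarrow> 'a) topology" where
  "subst_shift_top r \<theta> =
     subtopology (product_topology (\<lambda>_. discrete_topology UNIV) UNIV) (subst_shift r \<theta>)"

text \<open>Automorphisms are total functions on \<open>int \<Rightarrow> 'a\<close>, of which only the restriction to the shift
  matters.\<close>

definition shift_Aut :: "nat \<Rightarrow> ('a \<Rightarrow> 'a list) \<Rightarrow> ((int \<Rightarrow> 'a) \<Rightarrow> int \<Rightarrow> 'a) set" where
  "shift_Aut r \<theta> = {\<Phi>. homeomorphic_map (subst_shift_top r \<theta>) (subst_shift_top r \<theta>) \<Phi> \<and>
     (\<forall>x\<in>subst_shift r \<theta>. \<Phi> (shift x) = shift (\<Phi> x))}"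

definition subst_inv :: "nat \<Rightarrow> ('a \<Rightarrow> 'a list) \<Rightarrow> nat \<Rightarrow> (int \<Rightarrow> 'a) \<Rightarrow> int \<Rightarrow> 'a" where
  "subst_inv r \<theta> n = inv_into (subst_shift r \<theta>) (subst_bi r \<theta> ^^ n)"

text \<open>\<open>block_map X \<Phi> l m\<close>: on \<open>X\<close>, the map \<open>\<Phi>\<close> is given by a local rule with window
  \<open>[n - l, n + m]\<close>.\<close>

definition block_map ::
    "(int \<Rightarrow> 'a) set \<Rightarrow> ((int \<Rightarrow> 'a) \<Rightarrow> int \<Rightarrow> 'a) \<Rightarrow> nat \<Rightarrow> nat \<Rightarrow> bool" where
  "block_map X \<Phi> l m \<longleftrightarrow>
     (\<exists>f :: 'a list \<Rightarrow> 'a. \<forall>x\<in>X. \<forall>n. \<Phi> x n = f (map x [n - int l..n + int m]))"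

definition left_radius :: "(int \<Rightarrow> 'a) set \<Rightarrow> ((int \<Rightarrow> 'a) \<Rightarrow> int \<Rightarrow> 'a) \<Rightarrow> nat" where
  "left_radius X \<Phi> = (LEAST l. \<exists>m. block_map X \<Phi> l m)"

definition right_radius :: "(int \<Rightarrow> 'a) set \<Rightarrow> ((int \<Rightarrow> 'a) \<Rightarrow> int \<Rightarrow> 'a) \<Rightarrow> nat" where
  "right_radius X \<Phi> = (LEAST m. \<exists>l. block_map X \<Phi> l m)"


section \<open>The \<open>r\<close>-adic integers\<close>

text \<open>An \<open>r\<close>-adic integer is its digit sequence, least significant digit first;
  \<open>radic_res r z n\<close> is the representative of \<open>z\<close> modulo \<open>r ^ n\<close> in \<open>{0..<r ^ n}\<close>.\<close>

definition radic_integers :: "nat \<Rightarrow> (nat \<Rightarrow> nat) set" where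
  "radic_integers r = {z. \<forall>n. z n < r}"

definition radic_res :: "nat \<Rightarrow> (nat \<Rightarrow> nat) \<Rightarrow> nat \<Rightarrow> nat" where
  "radic_res r z n = (\<Sum>i<n. z i * r ^ i)"

text \<open>The element with residue \<open>R n\<close> modulo \<open>r ^ n\<close> for all \<open>n\<close>, for a coherent sequence \<open>R\<close>
  (see \<open>radic_res_of_residues\<close> below).\<close>

definition radic_of_residues :: "nat \<Rightarrow> (nat \<Rightarrow> nat) \<Rightarrow> nat \<Rightarrow> nat" where
  "radic_of_residues r R = (\<lambda>n. (R (Suc n) mod r ^ Suc n) div r ^ n)"

definition radic_add :: "nat \<Rightarrow> (nat \<Rightarrow> nat) \<Rightarrow> (nat \<Rightarrow> nat) \<Rightarrow> nat \<Rightarrow> nat" where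
  "radic_add r x y = radic_of_residues r (\<lambda>n. radic_res r x n + radic_res r y n)"

definition radic_mult :: "nat \<Rightarrow> (nat \<Rightarrow> nat) \<Rightarrow> (nat \<Rightarrow> nat) \<Rightarrow> nat \<Rightarrow> nat" where
  "radic_mult r x y = radic_of_residues r (\<lambda>n. radic_res r x n * radic_res r y n)"

definition radic_of_int :: "nat \<Rightarrow> int \<Rightarrow> nat \<Rightarrow> nat" where
  "radic_of_int r k = radic_of_residues r (\<lambda>n. nat (k mod int r ^ n))"

definition radic_periodic :: "(nat \<Rightarrow> nat) \<Rightarrow> bool" where
  "radic_periodic z \<longleftrightarrow> (\<exists>p\<ge>1. \<forall>n. z (n + p) = z n)"

text \<open>\<open>z = a / b\<close> in the \<open>r\<close>-adic integers. For \<open>b\<close> coprime to \<open>r\<close>, in particular for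
  \<open>b = 1 - r ^ p\<close> with \<open>p \<ge> 1\<close>, there is exactly one such \<open>z\<close>.\<close>

definition radic_is_quotient :: "nat \<Rightarrow> (nat \<Rightarrow> nat) \<Rightarrow> int \<Rightarrow> int \<Rightarrow> bool" where
  "radic_is_quotient r z a b \<longleftrightarrow>
     z \<in> radic_integers r \<and> radic_mult r (radic_of_int r b) z = radic_of_int r a"

lemma radic_res_of_residues:
  assumes "\<And>n. R (Suc n) mod r ^ n = R n mod r ^ n"
  shows "radic_res r (radic_of_residues r R) n = R n mod r ^ n"
proof (induction n)
  case 0
  then show ?case by (simp add: radic_res_def)
next
  case (Suc n)
  have "R (Suc n) mod r ^ Suc n mod r ^ n = R n mod r ^ n"
    using assms[of n] by (simp add: mod_mod_cancel)
  then show ?case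
    using Suc div_mult_mod_eq[of "R (Suc n) mod r ^ Suc n" "r ^ n"]
    by (simp add: radic_res_def radic_of_residues_def)
qed


section \<open>The maximal equicontinuous factor\<close>

definition mef_map :: "nat \<Rightarrow> ('a \<Rightarrow> 'a list) \<Rightarrow> (int \<Rightarrow> 'a) \<Rightarrow> nat \<Rightarrow> nat" where
  "mef_map r \<theta> x = (THE z. z \<in> radic_integers r \<and>
     (\<forall>n. \<forall>i<r ^ n. radic_res r z n = i \<longleftrightarrow>
        x \<in> shift_pow (int i) ` (subst_bi r \<theta> ^^ n) ` subst_shift r \<theta>))"

definition kappa :: "nat \<Rightarrow> ('a \<Rightarrow> 'a list) \<Rightarrow> ((int \<Rightarrow> 'a) \<Rightarrow> int \<Rightarrow> 'a) \<Rightarrow> nat \<Rightarrow> nat" where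
  "kappa r \<theta> \<Phi> = (THE z. z \<in> radic_integers r \<and>
     (\<forall>x\<in>subst_shift r \<theta>. mef_map r \<theta> (\<Phi> x) = radic_add r z (mef_map r \<theta> x)))"

end

theory Submission
  imports Defs
begin

text \<open>
  For an automorphism \<open>\<Phi>\<close> with \<open>\<kappa>(\<Phi>) = k / (1 - r\<^sup>p)\<close>, the map \<open>\<theta>\<^sup>-\<^sup>p \<circ> \<sigma>\<^sup>-\<^sup>k \<circ> \<Phi> \<circ> \<theta>\<^sup>p\<close> is
  again well defined, because \<open>\<kappa>(\<Phi>) - k\<close> is divisible by \<open>r\<^sup>p\<close>, and its \<open>\<kappa>\<close> is again \<open>\<kappa>(\<Phi>)\<close>.
  At most \<open>c\<close> maps share a given \<open>\<kappa>\<close>, since some fibre of \<open>\<pi>\<close> has at most \<open>c\<close> points and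
  \<open>X\<^sub>\<theta>\<close> is minimal. So this injective renormalization has a period at most \<open>c\<close> at \<open>\<Phi>\<close>, and its
  \<open>c!\<close>-th power fixes \<open>\<Phi>\<close>. Iterating further divides the window of a local rule by
  arbitrarily large powers of \<open>r\<close>, which bounds the radii.
\<close>

section \<open>Letters of iterated substitutions\<close>

text \<open>Two points carry the weight. Recognizability is what makes \<open>mef_map\<close> and
  \<open>kappa\<close> meaningful: a point must have only one phase modulo \<open>r ^ n\<close>. It
  is derived from minimality. The return times to \<open>Y n\<close> form a subgroup of the integers
  whose generator divides \<open>r ^ n\<close>; the absence of long repetitions bounds the quotient,
  and a comparison of two levels forces it to be 1. The asymmetry of the radii comes from the shift
  accumulated by the renormalization. After N = p J substitutions it is K = k (r^N - 1) / (r^p - 1).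
  For a rule of radius R, one block of r^N output letters reads the positions from -K - R to r^N - 1
  - K + R. If 0 < k < r^p - 1, then K moves away from both 0 and r^N as J grows, so these positions
  end up inside the blocks -1 and 0. The end values k = 0 and k = r^p - 1 are the rotation numbers 0
  and -1. For K = 0 the positions spill over on both sides, into the blocks -1 and 1.\<close>

primrec subst_letter :: "nat \<Rightarrow> ('a \<Rightarrow> 'a list) \<Rightarrow> nat \<Rightarrow> 'a \<Rightarrow> nat \<Rightarrow> 'a" where
  "subst_letter r \<theta> 0 a t = a"
| "subst_letter r \<theta> (Suc m) a t = \<theta> (subst_letter r \<theta> m a (t div r)) ! (t mod r)"

lemma subst_letter_add:
  "subst_letter r \<theta> (m + n) a t =
     subst_letter r \<theta> m (subst_letter r \<theta> n a (t div r ^ m)) (t mod r ^ m)"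
proof (induction m arbitrary: t)
  case (Suc m)
  have "(t mod (r * r ^ m)) div r = (t div r) mod r ^ m"
    by (cases "r = 0") (auto simp: mod_mult2_eq)
  moreover have "(t mod (r * r ^ m)) mod r = t mod r"
    by (simp add: mod_mod_cancel)
  ultimately show ?case
    using Suc[of "t div r"] by (simp add: div_mult2_eq)
qed simp

text \<open>The base-r digits of a position are the column indices applied to the letter, the least
  significant digit outermost. Hence a composition of m columns is a single column of theta^m, at
  the position whose digits are \<open>ks\<close>.\<close>

lemma subst_letter_column:
  "\<exists>j<r ^ length ks. \<forall>a. subst_letter r \<theta> (length ks) a j = column_comp \<theta> ks a"
  if "set ks \<subseteq> {..<r}"
  using that
proof (induction ks)
  case Nil
  then show ?case by (auto simp: column_comp_def)
next
  case (Cons i ks)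
  then obtain j where j: "j < r ^ length ks"
      "\<And>a. subst_letter r \<theta> (length ks) a j = column_comp \<theta> ks a"
    by auto
  have i: "i < r" using Cons.prems by simp
  have "i + r * j < r + r * j" using i by simp
  also have "\<dots> = r * Suc j" by simp
  also have "\<dots> \<le> r * r ^ length ks" using j(1) by (intro mult_le_mono) auto
  finally have "i + r * j < r ^ length (i # ks)" by simp
  moreover have "subst_letter r \<theta> (length (i # ks)) a (i + r * j) = column_comp \<theta> (i # ks) a" for a
    using i j(2)[of a] by (simp add: column_comp_def)
  ultimately show ?case by blast
qed

lemma subst_bi_funpow:
  "(subst_bi r \<theta> ^^ m) x j = subst_letter r \<theta> m (x (j div int r ^ m)) (nat (j mod int r ^ m))"
  if "r > 0"
proof (induction m arbitrary: j)
  case (Suc m)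
  define R where "R = int r ^ m"
  have R: "R > 0" and R': "nat R = r ^ m" using that by (auto simp: R_def nat_power_eq)
  have 1: "j mod (int r * R) div int r = (j div int r) mod R"
    using that R by (simp add: zmod_zmult2_eq)
  have 2: "j mod (int r * R) mod int r = j mod int r"
    by (simp add: mod_mod_cancel)
  have 3: "j div int r div R = j div (int r * R)"
    using that R by (simp add: zdiv_zmult2_eq)
  have 4: "nat (j mod (int r * R)) div r = nat ((j div int r) mod R)"
    using nat_div_distrib[of "j mod (int r * R)" "int r"] that R 1
    by simp
  have 5: "nat (j mod (int r * R)) mod r = nat (j mod int r)"
    using nat_mod_distrib[of "j mod (int r * R)" "int r"] that R 2
    by simp
  show ?case
    using Suc[of "j div int r"] 3 4 5 by (simp add: subst_bi_def R_def)
qed simp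

lemma subst_one_funpow:
  "(subst_one r \<theta> ^^ m) u j = subst_letter r \<theta> m (u (j div r ^ m)) (j mod r ^ m)"
proof (induction m arbitrary: j)
  case (Suc m)
  have "(j mod (r * r ^ m)) div r = (j div r) mod r ^ m"
    by (cases "r = 0") (auto simp: mod_mult2_eq)
  moreover have "(j mod (r * r ^ m)) mod r = j mod r"
    by (simp add: mod_mod_cancel)
  ultimately show ?case
    using Suc[of "j div r"] by (simp add: subst_one_def div_mult2_eq)
qed simp

lemma length_subst_word: "length (subst_word \<theta> w) = length w * r" if "substitution r \<theta>"
  using that by (induction w) (auto simp: subst_word_def substitution_def)

lemma length_subst_word_funpow: "length ((subst_word \<theta> ^^ m) w) = length w * r ^ m"
  if "substitution r \<theta>"
  by (induction m) (auto simp: length_subst_word[OF that])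

lemma nth_subst_word: "subst_word \<theta> w ! t = \<theta> (w ! (t div r)) ! (t mod r)"
  if "substitution r \<theta>" "t < length w * r"
  using that(2)
proof (induction w arbitrary: t)
  case (Cons a w)
  have len: "length (\<theta> a) = r" using that(1) by (auto simp: substitution_def)
  show ?case
  proof (cases "t < r")
    case True
    then show ?thesis using len by (simp add: subst_word_def nth_append)
  next
    case False
    have r: "r > 0" using Cons.prems by (cases r) auto
    have "subst_word \<theta> (a # w) ! t = subst_word \<theta> w ! (t - r)"
      using False len by (simp add: subst_word_def nth_append)
    also have "\<dots> = \<theta> (w ! ((t - r) div r)) ! ((t - r) mod r)"
      using Cons False by auto
    also have "(t - r) mod r = t mod r" using False by (simp add: le_mod_geq)
    also have "w ! ((t - r) div r) = (a # w) ! (t div r)"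
      using False r by (simp add: le_div_geq)
    finally show ?thesis .
  qed
qed simp

lemma nth_subst_word_funpow:
  "(subst_word \<theta> ^^ m) [a] ! t = subst_letter r \<theta> m a t"
  if "substitution r \<theta>" "t < r ^ m"
  using that(2)
proof (induction m arbitrary: t)
  case (Suc m)
  have "t div r < r ^ m"
    using Suc.prems by (simp add: less_mult_imp_div_less mult.commute)
  then show ?case
    using Suc.IH[of "t div r"] Suc.prems
      nth_subst_word[OF that(1), of t "(subst_word \<theta> ^^ m) [a]"]
    by (simp add: length_subst_word_funpow[OF that(1)] mult.commute)
qed simp

lemma shift_pow_apply [simp]: "shift_pow m x n = x (n + m)"
  by (simp add: shift_pow_def)

lemma shift_pow_add: "shift_pow m (shift_pow n x) = shift_pow (m + n) x"
  by (auto simp: shift_pow_def add.assoc)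

lemma shift_pow_0 [simp]: "shift_pow 0 x = x"
  by (auto simp: shift_pow_def)

lemma subst_bi_funpow_shift:
  "(subst_bi r \<theta> ^^ m) (shift_pow k x) = shift_pow (k * int r ^ m) ((subst_bi r \<theta> ^^ m) x)"
  if "r > 0"
  using that by (auto simp: subst_bi_funpow fun_eq_iff add.commute)

text \<open>Two points are compared at two positions, so commutation with the shift is part of the
  notion and no function on words has to be named.\<close>

definition radius_rule ::
    "(int \<Rightarrow> 'a) set \<Rightarrow> ((int \<Rightarrow> 'a) \<Rightarrow> int \<Rightarrow> 'a) \<Rightarrow> nat \<Rightarrow> bool" where
  "radius_rule X \<Phi> R \<longleftrightarrow> (\<forall>x\<in>X. \<forall>y\<in>X. \<forall>i j.
     (\<forall>t. \<bar>t\<bar> \<le> int R \<longrightarrow> x (i + t) = y (j + t)) \<longrightarrow> \<Phi> x i = \<Phi> y j)"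

section \<open>Primitive aperiodic substitutions\<close>

locale aperiodic_substitution =
  fixes \<theta> :: "'a::finite \<Rightarrow> 'a list" and r :: nat
  assumes len: "substitution r \<theta>"
    and injective: "inj \<theta>"
    and primitive: "primitive_subst \<theta>"
    and infinite_shift: "infinite (subst_shift r \<theta>)"
begin

abbreviation X where "X \<equiv> subst_shift r \<theta>"
abbreviation G where "G \<equiv> subst_letter r \<theta>"
abbreviation \<Theta> where "\<Theta> n \<equiv> subst_bi r \<theta> ^^ n"
abbreviation Y where "Y n \<equiv> \<Theta> n ` X"

text \<open>For r at most 1 every iterate theta^k(a) has at most one letter, so primitivity leaves a
  single letter and the shift would be finite.\<close>

lemma r_ge_2: "r \<ge> 2"
proof (rule ccontr)
  assume "\<not> r \<ge> 2"
  then have r: "r = 0 \<or> r = 1" by auto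
  obtain k where k: "k \<ge> 1" "\<And>a b. b \<in> set ((subst_word \<theta> ^^ k) [a])"
    using primitive by (auto simp: primitive_subst_def)
  have l: "length ((subst_word \<theta> ^^ k) [a]) \<le> 1" for a
    using length_subst_word_funpow[OF len, of k "[a]"] r k(1) by (auto simp: power_0_left)
  have "a = b" for a b :: 'a
    using k(2)[of a a] k(2)[of b a] l[of a]
    by (cases "(subst_word \<theta> ^^ k) [a]") auto
  then have "x = y" for x y :: "int \<Rightarrow> 'a" by auto
  then have "X \<subseteq> {undefined}" by blast
  then show False using infinite_shift finite_subset by auto
qed

lemma r_pos [simp]: "r > 0" "int r > 0"
  using r_ge_2 by auto

lemma rpow_ge: "n < r ^ n"
  using r_ge_2 by (simp add: power_gt_expt)

text \<open>Injectivity passes to theta^m by peeling off the outermost substitution, one block of r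
  letters at a time.\<close>

lemma G_inj: "a = b" if "\<And>t. t < r ^ m \<Longrightarrow> G m a t = G m b t"
  using that
proof (induction m)
  case (Suc m)
  show ?case
  proof (rule Suc.IH)
    fix t assume t: "t < r ^ m"
    have "\<theta> (G m a t) = \<theta> (G m b t)"
    proof (rule nth_equalityI)
      show "length (\<theta> (G m a t)) = length (\<theta> (G m b t))"
        using len by (auto simp: substitution_def)
      fix s assume "s < length (\<theta> (G m a t))"
      then have s: "s < r" using len by (auto simp: substitution_def)
      have "s + r * t < r * Suc t" using s by simp
      also have "\<dots> \<le> r ^ Suc m" using t by (auto simp del: mult_Suc_right intro!: mult_le_mono)
      finally show "\<theta> (G m a t) ! s = \<theta> (G m b t) ! s"
        using Suc.prems[of "s + r * t"] s by simp
    qed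
    then show "G m a t = G m b t" using injective by (auto dest: injD)
  qed
qed simp

lemma primitive_G: "\<exists>K. \<forall>k\<ge>K. \<forall>a b. \<exists>t<r ^ k. G k a t = b"
proof -
  obtain k where k: "k \<ge> 1" "\<And>a b. b \<in> set ((subst_word \<theta> ^^ k) [a])"
    using primitive by (auto simp: primitive_subst_def)
  have "\<exists>t<r ^ k'. G k' a t = b" if "k' \<ge> k" for k' a b
  proof -
    define n where "n = k' - k"
    have k': "k' = k + n" using that by (simp add: n_def)
    obtain t where t: "t < r ^ k" "G k (G n a 0) t = b"
      using k(2)[of b "G n a 0"] length_subst_word_funpow[OF len, of k "[G n a 0]"]
        nth_subst_word_funpow[OF len] by (auto simp: in_set_conv_nth)
    have "r ^ k \<le> r ^ k'" using r_ge_2 k' by (intro power_increasing) auto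
    then have "t < r ^ k'" using t(1) by simp
    then show ?thesis using t k' by (auto simp: subst_letter_add intro!: exI[of _ t])
  qed
  then show ?thesis by blast
qed

section \<open>The language of the substitution (\<open>occ\<close>: factors of the iterates
  theta^m(a)) and uniform recurrence\<close>

definition occ :: "nat \<Rightarrow> (nat \<Rightarrow> 'a) \<Rightarrow> bool" where
  "occ n f \<longleftrightarrow> (\<exists>m a j. j + n \<le> r ^ m \<and> (\<forall>t<n. f t = G m a (j + t)))"

lemma occ_cong: "occ n f \<longleftrightarrow> occ n g" if "\<And>t. t < n \<Longrightarrow> f t = g t"
  using that by (auto simp: occ_def)

lemma occ_sub:
  assumes "occ n f" and "a + n' \<le> n"
  shows "occ n' (\<lambda>t. f (a + t))"
proof -
  obtain m b j where "j + n \<le> r ^ m" "\<forall>t<n. f t = G m b (j + t)"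
    using assms(1) unfolding occ_def by blast
  then show ?thesis
    unfolding occ_def using assms(2)
    by (intro exI[of _ m] exI[of _ b] exI[of _ "j + a"]) (auto simp: add.assoc)
qed

text \<open>The word lies in some theta^m(a), and by primitivity the letter a lies in theta^(k-m)(b)
  for every b once k is large.\<close>

lemma occ_everywhere:
  assumes "occ n f"
  shows "\<exists>K. \<forall>k\<ge>K. \<forall>b. \<exists>j. j + n \<le> r ^ k \<and> (\<forall>t<n. f t = G k b (j + t))"
proof -
  obtain m a j where j: "j + n \<le> r ^ m" "\<And>t. t < n \<Longrightarrow> f t = G m a (j + t)"
    using assms by (auto simp: occ_def)
  obtain K where K: "\<And>k a b. k \<ge> K \<Longrightarrow> \<exists>t<r ^ k. G k a t = b"
    using primitive_G by blast
  have "\<exists>j. j + n \<le> r ^ k \<and> (\<forall>t<n. f t = G k b (j + t))" if k: "k \<ge> K + m" for k b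
  proof -
    have "K \<le> k - m" using k by simp
    then obtain s where s: "s < r ^ (k - m)" "G (k - m) b s = a"
      using K[where k = "k - m" and a = b and b = a] by blast
    have km: "k = m + (k - m)" using k by simp
    have "s * r ^ m + j + n \<le> Suc s * r ^ m" using j(1) by simp
    also have "\<dots> \<le> r ^ (k - m) * r ^ m" using s(1) by (intro mult_le_mono) auto
    also have "\<dots> = r ^ k" using km by (metis mult.commute power_add)
    finally have "s * r ^ m + j + n \<le> r ^ k" .
    moreover have "f t = G k b (s * r ^ m + j + t)" if "t < n" for t
    proof -
      have "j + t < r ^ m" using j(1) that by simp
      then have "(s * r ^ m + j + t) div r ^ m = s" "(s * r ^ m + j + t) mod r ^ m = j + t"
        using div_mult_self3[of "r ^ m" s "j + t"] mod_mult_self3[of s "r ^ m" "j + t"]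
        by (simp_all add: add.assoc)
      then show ?thesis
        using j(2)[OF that] s(2) subst_letter_add[of r \<theta> m "k - m" b "s * r ^ m + j + t"] km
        by simp
    qed
    ultimately show ?thesis by (intro exI[of _ "s * r ^ m + j"]) auto
  qed
  then show ?thesis by blast
qed

text \<open>A point u fixed by theta^N begins with theta^(N q)(u 0) for every q, so by primitivity
  its factors are the whole language. This frees membership in the shift from the choice of
  u.\<close>

lemma shift_iff: "x \<in> X \<longleftrightarrow> (\<forall>i n. occ n (\<lambda>t. x (i + int t)))"
proof
  assume "x \<in> X"
  then obtain u N where u: "\<And>i n. \<exists>j. \<forall>t<n. x (i + int t) = u (j + t)"
    and N: "N \<ge> 1" "(subst_one r \<theta> ^^ N) u = u"
    by (auto simp: subst_shift_def periodic_point_def)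
  have uq: "(subst_one r \<theta> ^^ (N * q)) u = u" for q
    by (induction q) (auto simp: funpow_add N(2))
  show "\<forall>i n. occ n (\<lambda>t. x (i + int t))"
  proof (intro allI)
    fix i n
    obtain j where j: "\<And>t. t < n \<Longrightarrow> x (i + int t) = u (j + t)" using u by blast
    have "j + n \<le> N * (j + n)" using N(1) by simp
    also have "\<dots> \<le> r ^ (N * (j + n))" using rpow_ge by (simp add: less_imp_le)
    finally have jn: "j + n \<le> r ^ (N * (j + n))" .
    have "u (j + t) = G (N * (j + n)) (u 0) (j + t)" if "t < n" for t
      using subst_one_funpow[of "N * (j + n)" r \<theta> u "j + t"] uq[of "j + n"] jn that by simp
    then show "occ n (\<lambda>t. x (i + int t))"
      unfolding occ_def using j jn by (intro exI[of _ "N * (j + n)"] exI[of _ "u 0"] exI[of _ j]) auto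
  qed
next
  assume *: "\<forall>i n. occ n (\<lambda>t. x (i + int t))"
  have "X \<noteq> {}" using infinite_shift by auto
  then obtain u where pu: "periodic_point r \<theta> u"
    by (auto simp: subst_shift_def)
  then obtain N where N: "N \<ge> 1" "(subst_one r \<theta> ^^ N) u = u"
    by (auto simp: periodic_point_def)
  have uq: "(subst_one r \<theta> ^^ (N * q)) u = u" for q
    by (induction q) (auto simp: funpow_add N(2))
  have "\<exists>j. \<forall>t<n. x (i + int t) = u (j + t)" for i n
  proof -
    obtain K where K: "\<And>k b. k \<ge> K \<Longrightarrow>
        \<exists>j. j + n \<le> r ^ k \<and> (\<forall>t<n. x (i + int t) = G k b (j + t))"
      using occ_everywhere *[rule_format, of n i] by blast
    have "N * K \<ge> K" using N(1) by simp
    then obtain j where j: "j + n \<le> r ^ (N * K)"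
        "\<And>t. t < n \<Longrightarrow> x (i + int t) = G (N * K) (u 0) (j + t)"
      using K by blast
    have "u (j + t) = G (N * K) (u 0) (j + t)" if "t < n" for t
      using subst_one_funpow[of "N * K" r \<theta> u "j + t"] uq[of K] j(1) that by simp
    then show ?thesis using j(2) by (intro exI[of _ j]) simp
  qed
  then show "x \<in> X" using pu by (auto simp: subst_shift_def)
qed

lemma occ_shift: "x \<in> X \<Longrightarrow> occ n (\<lambda>t. x (i + int t))"
  by (simp add: shift_iff)

lemma shift_pow_in [simp]: "shift_pow m x \<in> X \<longleftrightarrow> x \<in> X"
proof -
  have 1: "shift_pow m x \<in> X" if "x \<in> X" for m x
    unfolding shift_iff
  proof (intro allI)
    fix i n
    show "occ n (\<lambda>t. shift_pow m x (i + int t))"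
      using occ_shift[OF that, of n "i + m"] by (simp add: add.commute add.left_commute)
  qed
  from 1[of "shift_pow m x" "- m"] 1[of x m] show ?thesis by (auto simp: shift_pow_add)
qed

text \<open>Place the word inside theta^(K+k)(a) = theta^k(theta^K(a)) and cut at the multiples of
  \<open>r ^ k\<close>. The letters of theta^K(a) from the block of the word's first position on
  serve as \<open>y\<close>.\<close>

lemma occ_desubstitute:
  assumes "occ n f"
  shows "\<exists>i<r ^ k. \<exists>y n'. occ n' y \<and> i + n \<le> n' * r ^ k \<and>
    (\<forall>t<n. f t = G k (y ((i + t) div r ^ k)) ((i + t) mod r ^ k))"
proof -
  obtain K where K: "\<And>k b. k \<ge> K \<Longrightarrow> \<exists>j. j + n \<le> r ^ k \<and> (\<forall>t<n. f t = G k b (j + t))"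
    using occ_everywhere[OF assms] by blast
  fix a :: 'a
  define m where "m = K + k"
  obtain j where j: "j + n \<le> r ^ m" "\<And>t. t < n \<Longrightarrow> f t = G m a (j + t)"
    using K[of m a] by (auto simp: m_def)
  have m: "m = k + K" by (simp add: m_def)
  define b where "b = j div r ^ k"
  define i where "i = j mod r ^ k"
  have jb: "j = b * r ^ k + i" unfolding b_def i_def by (rule div_mult_mod_eq[symmetric])
  have i: "i < r ^ k" by (simp add: i_def)
  have rm: "r ^ m = r ^ K * r ^ k" by (simp add: m power_add)
  have "b * r ^ k \<le> r ^ K * r ^ k" using j(1) jb rm by linarith
  then have bK: "b \<le> r ^ K" by (subst (asm) mult_le_cancel2) simp
  have "occ (r ^ K - b) (\<lambda>s. G K a (b + s))"
    unfolding occ_def using bK by (intro exI[of _ K] exI[of _ a] exI[of _ b]) auto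
  moreover have "i + n \<le> (r ^ K - b) * r ^ k"
    using j(1) jb rm by (simp add: diff_mult_distrib)
  moreover have "f t = G k (G K a (b + (i + t) div r ^ k)) ((i + t) mod r ^ k)" if "t < n" for t
  proof -
    have "(j + t) div r ^ k = b + (i + t) div r ^ k" "(j + t) mod r ^ k = (i + t) mod r ^ k"
      using div_mult_self3[of "r ^ k" b "i + t"] mod_mult_self3[of b "r ^ k" "i + t"]
      by (simp_all add: jb add.assoc)
    then show ?thesis using j(2)[OF that] m by (simp add: subst_letter_add)
  qed
  ultimately show ?thesis using i by blast
qed

lemma occ_substitute:
  assumes "occ n' y" and "i + n \<le> n' * r ^ k"
    and "\<And>t. t < n \<Longrightarrow> f t = G k (y ((i + t) div r ^ k)) ((i + t) mod r ^ k)"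
  shows "occ n f"
proof -
  obtain m a j where j: "j + n' \<le> r ^ m" "\<And>t. t < n' \<Longrightarrow> y t = G m a (j + t)"
    using assms(1) by (auto simp: occ_def)
  have "j * r ^ k + i + n \<le> (j + n') * r ^ k" using assms(2) by (simp add: distrib_right)
  also have "\<dots> \<le> r ^ m * r ^ k" using j(1) by (rule mult_le_mono1)
  finally have 1: "j * r ^ k + i + n \<le> r ^ (k + m)" by (simp add: power_add mult.commute)
  have "f t = G (k + m) a (j * r ^ k + i + t)" if "t < n" for t
  proof -
    have "(i + t) div r ^ k < n'"
      using assms(2) that by (simp add: less_mult_imp_div_less)
    moreover have "(j * r ^ k + i + t) div r ^ k = j + (i + t) div r ^ k"
        "(j * r ^ k + i + t) mod r ^ k = (i + t) mod r ^ k"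
      using div_mult_self3[of "r ^ k" j "i + t"] mod_mult_self3[of j "r ^ k" "i + t"]
      by (simp_all add: add.assoc)
    ultimately show ?thesis using assms(3)[OF that] j(2) by (simp add: subst_letter_add)
  qed
  then show ?thesis using 1 unfolding occ_def by blast
qed

text \<open>Whatever its offset modulo \<open>r ^ k\<close>, a word of length 2 r^k contains the
  complete image theta^k(b) of its second desubstituted letter, and for suitable k every such image
  contains f.\<close>

lemma occ_recurrent_aux:
  assumes "occ n f"
  shows "\<exists>M. \<forall>g. occ M g \<longrightarrow> (\<exists>j. j + n \<le> M \<and> (\<forall>t<n. g (j + t) = f t))"
proof -
  obtain k where k: "\<And>b. \<exists>j. j + n \<le> r ^ k \<and> (\<forall>t<n. f t = G k b (j + t))"
    using occ_everywhere[OF assms] by blast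
  have "\<exists>j. j + n \<le> 2 * r ^ k \<and> (\<forall>t<n. g (j + t) = f t)" if g: "occ (2 * r ^ k) g" for g
  proof -
    obtain i y where i: "i < r ^ k" and
        y: "\<And>t. t < 2 * r ^ k \<Longrightarrow> g t = G k (y ((i + t) div r ^ k)) ((i + t) mod r ^ k)"
      using occ_desubstitute[OF g, of k] by blast
    obtain j where j: "j + n \<le> r ^ k" "\<And>t. t < n \<Longrightarrow> f t = G k (y 1) (j + t)"
      using k by blast
    have "g (r ^ k - i + j + t) = f t" if "t < n" for t
    proof -
      have e: "i + (r ^ k - i + j + t) = r ^ k + (j + t)" using i by simp
      have jt: "j + t < r ^ k" using that j(1) by simp
      have "g (r ^ k - i + j + t) = G k (y 1) (j + t)"
        using y[of "r ^ k - i + j + t"] jt i unfolding e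
        by (simp add: div_add_self1 mod_add_self1)
      then show ?thesis using j(2)[OF that] by simp
    qed
    moreover have "r ^ k - i + j + n \<le> 2 * r ^ k" using j(1) by simp
    ultimately show ?thesis by blast
  qed
  then show ?thesis by blast
qed

lemma occ_recurrent:
  "\<exists>M. \<forall>f g. occ n f \<longrightarrow> occ M g \<longrightarrow> (\<exists>j. j + n \<le> M \<and> (\<forall>t<n. g (j + t) = f t))"
proof -
  define W where "W = {xs :: 'a list. length xs = n \<and> occ n (nth xs)}"
  have "finite {xs :: 'a list. set xs \<subseteq> UNIV \<and> length xs = n}"
    by (rule finite_lists_length_eq) simp
  then have fin: "finite W" unfolding W_def by (rule rev_finite_subset) auto
  have "\<forall>xs\<in>W. \<exists>M. \<forall>g. occ M g \<longrightarrow> (\<exists>j. j + n \<le> M \<and> (\<forall>t<n. g (j + t) = xs ! t))"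
    using occ_recurrent_aux by (auto simp: W_def)
  then obtain M where M: "\<And>xs g. xs \<in> W \<Longrightarrow> occ (M xs) g \<Longrightarrow>
      \<exists>j. j + n \<le> M xs \<and> (\<forall>t<n. g (j + t) = xs ! t)"
    by metis
  define N where "N = (\<Sum>xs\<in>W. M xs)"
  have "\<exists>j. j + n \<le> N \<and> (\<forall>t<n. g (j + t) = f t)" if f: "occ n f" and g: "occ N g" for f g
  proof -
    define xs where "xs = map f [0..<n]"
    have xs: "\<And>t. t < n \<Longrightarrow> xs ! t = f t" by (simp add: xs_def)
    have "xs \<in> W" using f occ_cong[of n "nth xs" f] xs by (simp add: W_def xs_def)
    moreover from this have MN: "M xs \<le> N" unfolding N_def using fin by (simp add: member_le_sum)
    moreover have "occ (M xs) g" using occ_sub[OF g, of 0 "M xs"] MN by simp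
    ultimately show ?thesis using M[of xs g] xs by (metis le_trans)
  qed
  then show ?thesis by blast
qed

text \<open>Quantitative minimality. Since M depends on n alone, it can be fixed before the points
  are chosen, as \<open>no_high_powers\<close> and \<open>renorm_collision\<close> require.\<close>

lemma shift_recurrent:
  "\<exists>M. \<forall>x\<in>X. \<forall>y\<in>X. \<forall>i b. \<exists>s. b \<le> s \<and> s + int n \<le> b + int M \<and>
     (\<forall>t. 0 \<le> t \<and> t < int n \<longrightarrow> y (i + t) = x (s + t))"
proof -
  obtain M where M: "\<And>f g. occ n f \<Longrightarrow> occ M g \<Longrightarrow> \<exists>j. j + n \<le> M \<and> (\<forall>t<n. g (j + t) = f t)"
    using occ_recurrent by blast
  have "\<exists>s. b \<le> s \<and> s + int n \<le> b + int M \<and> (\<forall>t. 0 \<le> t \<and> t < int n \<longrightarrow> y (i + t) = x (s + t))"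
    if x: "x \<in> X" and y: "y \<in> X" for x y i b
  proof -
    obtain j where j: "j + n \<le> M" "\<And>t. t < n \<Longrightarrow> x (b + int (j + t)) = y (i + int t)"
      using M[OF occ_shift[OF y, of n i] occ_shift[OF x, of M b]] by auto
    have "y (i + t) = x (b + int j + t)" if "0 \<le> t" "t < int n" for t
      using j(2)[of "nat t"] that by (simp add: add.assoc)
    then show ?thesis using j(1) by (intro exI[of _ "b + int j"]) auto
  qed
  then show ?thesis by blast
qed

end

section \<open>Desubstitution\<close>

lemma finite_periodic_sequences:
  "finite {x :: int \<Rightarrow> 'a::finite. \<forall>t. x t = x (t + int q)}" if "q > 0"
proof (rule finite_imageD)
  let ?P = "{x :: int \<Rightarrow> 'a. \<forall>t. x t = x (t + int q)}"
  let ?f = "\<lambda>x :: int \<Rightarrow> 'a. map (x \<circ> int) [0..<q]"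
  have "finite {xs :: 'a list. set xs \<subseteq> UNIV \<and> length xs = q}"
    by (rule finite_lists_length_eq) simp
  then show "finite (?f ` ?P)" by (rule rev_finite_subset) auto
  have multiples: "x t = x (t + int n * int q)" if "x \<in> ?P" for x t n
  proof (induction n)
    case (Suc n)
    have "x (t + int n * int q) = x (t + int n * int q + int q)" using that by blast
    then show ?case using Suc by (simp add: algebra_simps)
  qed simp
  have reduce: "x t = x (t mod int q)" if x: "x \<in> ?P" for x t
  proof (cases "t div int q \<ge> 0")
    case True
    then have "t mod int q + int (nat (t div int q)) * int q = t" by simp
    then show ?thesis using multiples[OF x, of "t mod int q" "nat (t div int q)"] by simp
  next
    case False
    then have "int (nat (- (t div int q))) = - (t div int q)" by simp
    then have "t + int (nat (- (t div int q))) * int q = t mod int q"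
      by (simp add: minus_div_mult_eq_mod)
    then show ?thesis using multiples[OF x, of t "nat (- (t div int q))"] by simp
  qed
  show "inj_on ?f ?P"
  proof (rule inj_onI)
    fix x y assume xy: "x \<in> ?P" "y \<in> ?P" "?f x = ?f y"
    show "x = y"
    proof
      fix t
      have "nat (t mod int q) < q" using that by (simp add: nat_less_iff)
      moreover have "\<forall>i<q. x (int i) = y (int i)" using xy(3) by auto
      ultimately have "x (int (nat (t mod int q))) = y (int (nat (t mod int q)))" by blast
      then have "x (t mod int q) = y (t mod int q)" using that by simp
      then show "x t = y t" using reduce[OF xy(1), of t] reduce[OF xy(2), of t] by simp
    qed
  qed
qed

lemma int_div_bounds: "0 \<le> t div R \<and> t div R < L" if "0 \<le> t" "t < L * R" "R > 0" for t R L :: int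
proof -
  have "t div R * R \<le> t" using that(3) by (metis div_mult_mod_eq pos_mod_sign le_add_same_cancel1)
  then have "t div R * R < L * R" using that(2) by linarith
  then show ?thesis using that by (simp add: pos_imp_zdiv_nonneg_iff)
qed

context aperiodic_substitution
begin

lemma rpow_pos [simp]: "int r ^ n > 0"
  by simp

lemma \<Theta>_apply: "\<Theta> k x j = G k (x (j div int r ^ k)) (nat (j mod int r ^ k))"
  by (rule subst_bi_funpow) simp

lemma \<Theta>_shift: "\<Theta> k (shift_pow m x) = shift_pow (m * int r ^ k) (\<Theta> k x)"
  by (rule subst_bi_funpow_shift) simp

text \<open>The letters of a desubstituted sequence are determined by \<open>x\<close>, so matching preimages of
  larger and larger windows of \<open>x\<close> glue together without a compactness argument.\<close>

lemma desubstitute_limit: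
  assumes "\<And>L. \<exists>z a n. occ n (\<lambda>t. z (a + int t)) \<and> (\<forall>j. \<bar>j\<bar> \<le> int L \<longrightarrow>
      a \<le> (j + p) div int r ^ k \<and> (j + p) div int r ^ k < a + int n \<and>
      x j = G k (z ((j + p) div int r ^ k)) (nat ((j + p) mod int r ^ k)))"
  shows "\<exists>y\<in>X. x = shift_pow p (\<Theta> k y)"
proof -
  define R where "R = int r ^ k"
  have R: "R > 0" "nat R = r ^ k" by (simp_all add: R_def nat_power_eq)
  \<comment> \<open>\<open>P b c\<close> says that block b of x, for the cutting offset p, is
    theta^k(c). By \<open>G_inj\<close> at most one letter c qualifies; this is what makes preimages
    from different windows compatible.\<close>
  define P where "P b c \<longleftrightarrow> (\<forall>t<r ^ k. x (b * R - p + int t) = G k c t)" for b c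
  define Q where "Q L z a n \<longleftrightarrow> occ n (\<lambda>t. z (a + int t)) \<and> (\<forall>j. \<bar>j\<bar> \<le> int L \<longrightarrow>
      a \<le> (j + p) div R \<and> (j + p) div R < a + int n \<and>
      x j = G k (z ((j + p) div R)) (nat ((j + p) mod R)))" for L z a n
  have Q: "\<exists>z a n. Q L z a n" for L
    unfolding Q_def R_def by (rule assms)
  have uniq: "c = c'" if "P b c" "P b c'" for b c c'
  proof (rule G_inj[of k])
    show "G k c t = G k c' t" if "t < r ^ k" for t
      using \<open>P b c\<close> \<open>P b c'\<close> that unfolding P_def by metis
  qed
  have PQ: "P b (z b) \<and> a \<le> b \<and> b < a + int n" if q: "Q L z a n" and L: "\<bar>b * R - p\<bar> + R \<le> int L" for L z a n b
  proof -
    have *: "a \<le> b \<and> b < a + int n \<and> x (b * R - p + int t) = G k (z b) t" if t: "t < r ^ k" for t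
    proof -
      have tR: "int t < R" using t unfolding R_def by (metis of_nat_less_iff of_nat_power)
      have j: "\<bar>b * R - p + int t\<bar> \<le> int L" using L tR by linarith
      have e: "b * R - p + int t + p = int t + b * R" by simp
      have d: "(int t + b * R) div R = b" "(int t + b * R) mod R = int t"
        using tR R(1) by (simp_all add: div_pos_pos_trivial)
      have "a \<le> (b * R - p + int t + p) div R \<and> (b * R - p + int t + p) div R < a + int n \<and>
          x (b * R - p + int t) = G k (z ((b * R - p + int t + p) div R)) (nat ((b * R - p + int t + p) mod R))"
        using q j unfolding Q_def by blast
      then show ?thesis unfolding e d nat_int .
    qed
    from *[of 0] have "a \<le> b \<and> b < a + int n" by simp
    with * show ?thesis by (simp add: P_def)
  qed
  have ex: "\<exists>c. P b c" for b
  proof -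
    obtain z a n where "Q (nat (\<bar>b * R - p\<bar> + R)) z a n" using Q by blast
    then have "P b (z b)" using PQ[of "nat (\<bar>b * R - p\<bar> + R)" z a n b] R(1) by simp
    then show ?thesis by blast
  qed
  define y where "y b = (SOME c. P b c)" for b
  have y: "P b (y b)" for b unfolding y_def using ex by (rule someI_ex)
  have "x j = shift_pow p (\<Theta> k y) j" for j
  proof -
    define b where "b = (j + p) div R"
    have m: "(j + p) mod R \<ge> 0" "(j + p) mod R < R" using R(1) by simp_all
    then have "nat ((j + p) mod R) < r ^ k" using R(2) by (metis nat_less_eq_zless)
    then have "x (b * R - p + int (nat ((j + p) mod R))) = G k (y b) (nat ((j + p) mod R))"
      using y[of b] unfolding P_def by blast
    moreover have e: "b * R - p + int (nat ((j + p) mod R)) = j"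
    proof -
      have "int (nat ((j + p) mod R)) = (j + p) mod R" using m(1) by simp
      then show ?thesis using div_mult_mod_eq[of "j + p" R] unfolding b_def by linarith
    qed
    ultimately have "x j = G k (y b) (nat ((j + p) mod R))" unfolding e by blast
    then show ?thesis by (simp add: \<Theta>_apply b_def R_def)
  qed
  moreover have "y \<in> X"
    unfolding shift_iff
  proof (intro allI)
    fix i n
    \<comment> \<open>Wide enough to show the blocks i, ..., i + n completely, so that n consecutive
      letters of y are read off one preimage word z, which is known to be in the language.\<close>
    define L where "L = nat (\<bar>i * R - p\<bar> + (int n + 1) * R)"
    have L: "int L = \<bar>i * R - p\<bar> + (int n + 1) * R" using R(1) by (simp add: L_def)
    obtain z a n' where q: "Q L z a n'" using Q by blast
    have b: "P (i + int t) (z (i + int t)) \<and> a \<le> i + int t \<and> i + int t < a + int n'" if "t \<le> n" for t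
    proof (rule PQ[OF q])
      have "\<bar>(i + int t) * R - p\<bar> \<le> \<bar>i * R - p\<bar> + int t * R"
        using R(1) abs_triangle_ineq[of "i * R - p" "int t * R"] by (simp add: algebra_simps)
      moreover have "int t * R \<le> int n * R" using that R(1) by (simp add: mult_right_mono)
      ultimately show "\<bar>(i + int t) * R - p\<bar> + R \<le> int L" by (simp add: L distrib_right)
    qed
    have "occ n (\<lambda>t. z (a + int (nat (i - a) + t)))"
      using q b[of 0] b[of n] by (intro occ_sub[where n = n' and f = "\<lambda>t. z (a + int t)"]) (auto simp: Q_def)
    moreover have "z (a + int (nat (i - a) + t)) = y (i + int t)" if "t < n" for t
      using b[of 0] b[of t] that uniq[OF y[of "i + int t"], of "z (i + int t)"] by auto
    ultimately show "occ n (\<lambda>t. y (i + int t))"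
      using occ_cong[of n "\<lambda>t. z (a + int (nat (i - a) + t))" "\<lambda>t. y (i + int t)"] by simp
  qed
  ultimately show ?thesis by blast
qed

text \<open>Every window of x admits one of the finitely many offsets below \<open>r ^ k\<close>,
  and an offset good for a window is good for the smaller ones. If each offset p failed at some
  window \<open>Lf p\<close>, the window of size the sum of all \<open>Lf p\<close> would admit
  none.\<close>

lemma desubstitute:
  assumes "x \<in> X"
  shows "\<exists>p<r ^ k. \<exists>y\<in>X. x = shift_pow (int p) (\<Theta> k y)"
proof -
  define R where "R = int r ^ k"
  have R: "R > 0" "nat R = r ^ k" by (simp_all add: R_def nat_power_eq)
  define Q where "Q p L \<longleftrightarrow> (\<exists>z a n. occ n (\<lambda>t. z (a + int t)) \<and> (\<forall>j. \<bar>j\<bar> \<le> int L \<longrightarrow>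
      a \<le> (j + int p) div R \<and> (j + int p) div R < a + int n \<and>
      x j = G k (z ((j + int p) div R)) (nat ((j + int p) mod R))))" for p L :: nat
  have ex: "\<exists>p<r ^ k. Q p L" for L
  proof -
    obtain i y n' where i: "i < r ^ k" "occ n' y" "i + (2 * L + 1) \<le> n' * r ^ k" and
      y: "\<And>t. t < 2 * L + 1 \<Longrightarrow> x (- int L + int t) = G k (y ((i + t) div r ^ k)) ((i + t) mod r ^ k)"
      using occ_desubstitute[OF occ_shift[OF assms, of "2 * L + 1" "- int L"], of k] by blast
    \<comment> \<open>The word starts at coordinate -L with offset i, so coordinate 0 comes after q
      full blocks at offset p. Reindexing by q gives it block number 0.\<close>
    define q where "q = (i + L) div r ^ k"
    define p where "p = (i + L) mod r ^ k"
    define z where "z b = y (nat (b + int q))" for b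
    have iL: "i + L = q * r ^ k + p" unfolding q_def p_def by (rule div_mult_mod_eq[symmetric])
    have "- int q \<le> (j + int p) div R \<and> (j + int p) div R < - int q + int n' \<and>
      x j = G k (z ((j + int p) div R)) (nat ((j + int p) mod R))" if j: "\<bar>j\<bar> \<le> int L" for j
    proof -
      define t where "t = nat (j + int L)"
      have t: "int t = j + int L" "t < 2 * L + 1" using j by (auto simp: t_def)
      have "int i + int L = int q * R + int p"
        using iL by (metis R_def of_nat_add of_nat_mult of_nat_power)
      then have it: "int (i + t) = (j + int p) + int q * R" using t(1) by simp
      have 1: "int ((i + t) div r ^ k) = (j + int p) div R + int q"
        using it R(1) by (simp add: zdiv_int R_def)
      have 2: "int ((i + t) mod r ^ k) = (j + int p) mod R"
        using it R(1) by (simp add: zmod_int R_def)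
      have "(i + t) div r ^ k < n'"
        using i(3) t(2) by (simp add: less_mult_imp_div_less)
      then show ?thesis
      proof (intro conjI)
        have "z ((j + int p) div R) = y ((i + t) div r ^ k)" by (simp add: z_def flip: 1)
        then show "x j = G k (z ((j + int p) div R)) (nat ((j + int p) mod R))"
          using y[OF t(2)] t(1) by (simp flip: 2)
      qed (use 1 in linarith)+
    qed
    moreover have "occ n' (\<lambda>t. z (- int q + int t))" using i(2) by (simp add: z_def)
    ultimately have "Q p L" unfolding Q_def by blast
    moreover have "p < r ^ k" by (simp add: p_def)
    ultimately show ?thesis by blast
  qed
  have mono: "Q p L'" if "Q p L" "L' \<le> L" for p L L'
  proof -
    have "\<bar>j\<bar> \<le> int L" if "\<bar>j\<bar> \<le> int L'" for j using that \<open>L' \<le> L\<close> by linarith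
    with that(1) show ?thesis unfolding Q_def by blast
  qed
  have "\<exists>p<r ^ k. \<forall>L. Q p L"
  proof (rule ccontr)
    assume "\<not> ?thesis"
    then obtain Lf where Lf: "\<And>p. p < r ^ k \<Longrightarrow> \<not> Q p (Lf p)" by metis
    obtain p where p: "p < r ^ k" "Q p (\<Sum>p<r ^ k. Lf p)" using ex by blast
    have "Lf p \<le> (\<Sum>p<r ^ k. Lf p)" using p(1) by (intro member_le_sum) auto
    then show False using mono p Lf by blast
  qed
  then obtain p where "p < r ^ k" "\<And>L. Q p L" by blast
  then show ?thesis
    using desubstitute_limit[of "int p" k x] unfolding Q_def R_def by blast
qed

lemma \<Theta>_in_shift: "\<Theta> k y \<in> X" if y: "y \<in> X"
  unfolding shift_iff
proof (intro allI)
  fix i n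
  define R where "R = int r ^ k"
  have R: "R > 0" by (simp add: R_def)
  define b where "b = i div R"
  define i0 where "i0 = nat (i mod R)"
  have i0: "int i0 = i mod R" using R by (simp add: i0_def)
  have 1: "i0 + n \<le> (i0 + n) * r ^ k" using zero_less_power[OF r_pos(1), of k] by (cases "r ^ k") auto
  have 2: "\<Theta> k y (i + int t) = G k (y (b + int ((i0 + t) div r ^ k))) ((i0 + t) mod r ^ k)" for t
  proof -
    have e: "i + int t = int (i0 + t) + b * R"
      using div_mult_mod_eq[of i R] by (simp add: i0 b_def)
    have "(i + int t) div R = b + int ((i0 + t) div r ^ k)"
      unfolding e using R by (simp add: zdiv_int R_def)
    moreover have "(i + int t) mod R = int ((i0 + t) mod r ^ k)"
      unfolding e using R by (simp add: zmod_int R_def)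
    ultimately show ?thesis by (simp add: \<Theta>_apply flip: R_def)
  qed
  show "occ n (\<lambda>t. \<Theta> k y (i + int t))"
    using occ_shift[OF y, of "i0 + n" b] 1 2 by (rule occ_substitute)
qed

section \<open>The sets theta^n(X): nesting, closedness, minimality\<close>

lemma Y_subset: "x \<in> Y n \<Longrightarrow> x \<in> X"
  using \<Theta>_in_shift by auto

lemma Y_add: "Y (m + n) = \<Theta> m ` Y n"
  by (simp add: funpow_add image_comp)

lemma Y_antimono: "x \<in> Y (m + n) \<Longrightarrow> x \<in> Y m"
  using Y_add[of m n] \<Theta>_in_shift by auto

lemma \<Theta>_in_Y: "x \<in> Y n \<Longrightarrow> \<Theta> m x \<in> Y (m + n)"
  using Y_add[of m n] by auto

text \<open>Only one block of the images is compared, at two unrelated positions. In this form it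
  yields injectivity of \<open>\<Theta> n\<close> and also pulls local rules back through theta^n in
  \<open>window_transfer\<close>.\<close>

lemma \<Theta>_local_inj: "x i = y j"
  if "\<And>t. 0 \<le> t \<Longrightarrow> t < int r ^ n \<Longrightarrow> \<Theta> n x (i * int r ^ n + t) = \<Theta> n y (j * int r ^ n + t)"
proof (rule G_inj[of n])
  fix t assume "t < r ^ n"
  then have t: "int t < int r ^ n" by (metis of_nat_less_iff of_nat_power)
  then show "G n (x i) t = G n (y j) t"
    using that[of "int t"] by (simp add: \<Theta>_apply)
qed

lemma \<Theta>_inj:
  assumes "\<Theta> n x = \<Theta> n y"
  shows "x = y"
proof
  show "x i = y i" for i by (rule \<Theta>_local_inj[of n]) (simp only: assms)
qed

text \<open>Closedness in the product topology, phrased with windows: the offset 0 is kept in the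
  limit, so \<open>desubstitute_limit\<close> applies with p = 0.\<close>

lemma Y_closed:
  assumes "\<And>L. \<exists>y\<in>Y k. \<forall>j. \<bar>j\<bar> \<le> int L \<longrightarrow> x j = y j"
  shows "x \<in> Y k"
proof -
  have "\<exists>y\<in>X. x = shift_pow 0 (\<Theta> k y)"
  proof (rule desubstitute_limit)
    fix L
    obtain y where y: "y \<in> X" "\<And>j. \<bar>j\<bar> \<le> int L \<Longrightarrow> x j = \<Theta> k y j" using assms[of L] by auto
    define a where "a = (- int L) div int r ^ k"
    define n where "n = nat (int L div int r ^ k - a + 1)"
    have "a \<le> (j + 0) div int r ^ k \<and> (j + 0) div int r ^ k < a + int n \<and>
      x j = G k (y ((j + 0) div int r ^ k)) (nat ((j + 0) mod int r ^ k))" if "\<bar>j\<bar> \<le> int L" for j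
    proof -
      have "a \<le> j div int r ^ k" unfolding a_def using that by (intro zdiv_mono1) auto
      moreover have "j div int r ^ k \<le> int L div int r ^ k" using that by (intro zdiv_mono1) auto
      ultimately show ?thesis using y(2)[OF that] by (auto simp: n_def \<Theta>_apply)
    qed
    then show "\<exists>z a n. occ n (\<lambda>t. z (a + int t)) \<and> (\<forall>j. \<bar>j\<bar> \<le> int L \<longrightarrow>
        a \<le> (j + 0) div int r ^ k \<and> (j + 0) div int r ^ k < a + int n \<and>
        x j = G k (z ((j + 0) div int r ^ k)) (nat ((j + 0) mod int r ^ k)))"
      using occ_shift[OF y(1)] by blast
  qed
  then show ?thesis by auto
qed

lemma orbit_dense:
  assumes "x \<in> X" "x' \<in> X"
  shows "\<exists>m. \<forall>j. \<bar>j\<bar> \<le> int M \<longrightarrow> x j = x' (j + m)"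
proof -
  obtain N where N: "\<And>x y i b. x \<in> X \<Longrightarrow> y \<in> X \<Longrightarrow> \<exists>s. b \<le> s \<and> s + int (2 * M + 1) \<le> b + int N \<and>
      (\<forall>t. 0 \<le> t \<and> t < int (2 * M + 1) \<longrightarrow> y (i + t) = x (s + t))"
    using shift_recurrent[of "2 * M + 1"] by blast
  obtain s where s: "\<And>t. 0 \<le> t \<Longrightarrow> t < int (2 * M + 1) \<Longrightarrow> x (- int M + t) = x' (s + t)"
    using N[OF assms(2,1), of 0 "- int M"] by blast
  have "x j = x' (j + (s + int M))" if "\<bar>j\<bar> \<le> int M" for j
    using s[of "j + int M"] that by (simp add: algebra_simps)
  then show ?thesis by blast
qed

text \<open>Endomorphisms of the shift in Curtis-Hedlund-Lyndon form. The class is closed under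
  renormalization without any discussion of inverse maps.\<close>

definition endo :: "((int \<Rightarrow> 'a) \<Rightarrow> int \<Rightarrow> 'a) \<Rightarrow> bool" where
  "endo \<Phi> \<longleftrightarrow> (\<forall>x\<in>X. \<Phi> x \<in> X) \<and> (\<exists>R. radius_rule X \<Phi> R)"

lemma endo_in: "endo \<Phi> \<Longrightarrow> x \<in> X \<Longrightarrow> \<Phi> x \<in> X"
  by (simp add: endo_def)

lemma endo_shift:
  assumes "endo \<Phi>" "x \<in> X"
  shows "\<Phi> (shift_pow m x) = shift_pow m (\<Phi> x)"
proof
  fix n
  obtain R where R: "radius_rule X \<Phi> R" using assms by (auto simp: endo_def)
  have "\<forall>t. \<bar>t\<bar> \<le> int R \<longrightarrow> shift_pow m x (n + t) = x (n + m + t)" by (simp add: algebra_simps)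
  then have "\<Phi> (shift_pow m x) n = \<Phi> x (n + m)"
    using R assms(2) shift_pow_in unfolding radius_rule_def by blast
  then show "\<Phi> (shift_pow m x) n = shift_pow m (\<Phi> x) n" by simp
qed

lemma endo_shift_pow: "endo (\<lambda>x. shift_pow m x)"
proof -
  have "radius_rule X (\<lambda>x. shift_pow m x) (nat \<bar>m\<bar>)"
    unfolding radius_rule_def by auto
  then show ?thesis by (auto simp: endo_def)
qed

lemma endo_comp:
  assumes "endo \<Phi>" "endo \<Psi>"
  shows "endo (\<lambda>x. \<Phi> (\<Psi> x))"
proof -
  obtain R S where R: "radius_rule X \<Phi> R" and S: "radius_rule X \<Psi> S"
    using assms by (auto simp: endo_def)
  have "radius_rule X (\<lambda>x. \<Phi> (\<Psi> x)) (R + S)"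
    unfolding radius_rule_def
  proof (intro ballI allI impI)
    fix x y i j assume x: "x \<in> X" and y: "y \<in> X" and
      *: "\<forall>t. \<bar>t\<bar> \<le> int (R + S) \<longrightarrow> x (i + t) = y (j + t)"
    have "\<Psi> x (i + t) = \<Psi> y (j + t)" if "\<bar>t\<bar> \<le> int R" for t
    proof -
      have "x (i + t + u) = y (j + t + u)" if "\<bar>u\<bar> \<le> int S" for u
        using * \<open>\<bar>t\<bar> \<le> int R\<close> that by (simp add: add.assoc)
      then show ?thesis using S x y unfolding radius_rule_def by blast
    qed
    then show "\<Phi> (\<Psi> x) i = \<Phi> (\<Psi> y) j"
      using R endo_in[OF assms(2)] x y unfolding radius_rule_def by blast
  qed
  then show ?thesis using assms by (auto simp: endo_def)
qed

lemma abs_div_le: "\<bar>j div int r ^ n\<bar> \<le> int M" if "\<bar>j\<bar> \<le> int M"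
proof -
  have "int r ^ n \<ge> 1" using rpow_pos[of n] by linarith
  then have "int M \<le> int M * int r ^ n" by (simp add: mult_le_cancel_left1)
  then have j: "(- int M) * int r ^ n \<le> j" "j \<le> int M * int r ^ n" using that by auto
  have "(- int M) * int r ^ n div int r ^ n \<le> j div int r ^ n"
       "j div int r ^ n \<le> int M * int r ^ n div int r ^ n"
    by (rule zdiv_mono1[OF j(1) rpow_pos], rule zdiv_mono1[OF j(2) rpow_pos])
  then have "- int M \<le> j div int r ^ n" "j div int r ^ n \<le> int M"
    using rpow_pos[of n] by (simp_all only: nonzero_mult_div_cancel_right less_imp_neq[symmetric] not_False_eq_True)
  then show ?thesis by linarith
qed

text \<open>This is minimality of \<open>Y n\<close> under \<open>\<sigma>\<^bsup>r^n\<^esup>\<close>, applied to the closed invariant set \<open>\<Phi>\<^sup>-\<^sup>1(Y n)\<close>.\<close>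

lemma endo_maps_Y:
  assumes "endo \<Phi>" "x0 \<in> Y n" "\<Phi> x0 \<in> Y n" "x \<in> Y n"
  shows "\<Phi> x \<in> Y n"
proof (rule Y_closed)
  fix L
  obtain R where R: "radius_rule X \<Phi> R" using assms(1) by (auto simp: endo_def)
  obtain y0 y where y0: "y0 \<in> X" "x0 = \<Theta> n y0" and y: "y \<in> X" "x = \<Theta> n y"
    using assms(2,4) by auto
  define M where "M = L + R"
  \<comment> \<open>The approximation is made before substituting, so x is approximated by shifts of
    x0 by multiples of \<open>r ^ n\<close>, which keep the image under \<Phi> in
    \<open>Y n\<close>.\<close>
  obtain m where m: "\<And>j. \<bar>j\<bar> \<le> int M \<Longrightarrow> y j = y0 (j + m)" using orbit_dense[OF y(1) y0(1)] by blast
  have xx: "x j = \<Theta> n (shift_pow m y0) j" if "\<bar>j\<bar> \<le> int M" for j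
    using m[OF abs_div_le[OF that]] by (simp add: y(2) \<Theta>_apply)
  have z: "\<Theta> n (shift_pow m y0) \<in> X" using \<Theta>_in_shift y0(1) by simp
  have "\<Phi> x j = \<Phi> (\<Theta> n (shift_pow m y0)) j" if "\<bar>j\<bar> \<le> int L" for j
  proof -
    have "x (j + t) = \<Theta> n (shift_pow m y0) (j + t)" if "\<bar>t\<bar> \<le> int R" for t
      using xx \<open>\<bar>j\<bar> \<le> int L\<close> that by (simp add: M_def)
    then show ?thesis using R z Y_subset[OF assms(4)] unfolding radius_rule_def by blast
  qed
  moreover have "\<Phi> (\<Theta> n (shift_pow m y0)) \<in> Y n"
  proof -
    obtain y1 where "y1 \<in> X" "\<Phi> x0 = \<Theta> n y1" using assms(3) by auto
    then have "\<Phi> (\<Theta> n (shift_pow m y0)) = \<Theta> n (shift_pow m y1)"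
      using endo_shift[OF assms(1) Y_subset[OF assms(2)], of "m * int r ^ n"] y0(2)
      by (simp add: \<Theta>_shift)
    then show ?thesis using \<open>y1 \<in> X\<close> by simp
  qed
  ultimately show "\<exists>y\<in>Y n. \<forall>j. \<bar>j\<bar> \<le> int L \<longrightarrow> \<Phi> x j = y j" by blast
qed

section \<open>Recognizability\<close>

text \<open>The return times to \<open>Y n\<close>. One returning point is asked for; by minimality
  all points then return (\<open>returns_all\<close>), and so the set is a subgroup of the
  integers.\<close>

definition returns :: "nat \<Rightarrow> int set" where
  "returns n = {i. \<exists>x\<in>Y n. shift_pow i x \<in> Y n}"

lemma returns_all: "i \<in> returns n \<Longrightarrow> x \<in> Y n \<Longrightarrow> shift_pow i x \<in> Y n"
  unfolding returns_def using endo_maps_Y[OF endo_shift_pow] by blast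

lemma Y_nonempty: "\<exists>x. x \<in> Y n"
proof -
  obtain y where "y \<in> X" using infinite_shift by fastforce
  then show ?thesis by blast
qed

lemma returns_add: "i + j \<in> returns n" if "i \<in> returns n" "j \<in> returns n"
proof -
  obtain x where x: "x \<in> Y n" using Y_nonempty by blast
  then have "shift_pow (i + j) x \<in> Y n"
    using returns_all[OF that(1) returns_all[OF that(2) x]] by (simp add: shift_pow_add)
  then show ?thesis using x by (auto simp: returns_def)
qed

lemma returns_minus:
  assumes "i \<in> returns n"
  shows "- i \<in> returns n"
proof -
  obtain x where "x \<in> Y n" "shift_pow i x \<in> Y n" using assms by (auto simp: returns_def)
  moreover have "shift_pow (- i) (shift_pow i x) = x" by (simp add: shift_pow_add)
  ultimately show ?thesis unfolding returns_def by force
qed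

lemma returns_mult: "i \<in> returns n \<Longrightarrow> k * i \<in> returns n"
proof -
  assume i: "i \<in> returns n"
  have "i + - i \<in> returns n" using i by (intro returns_add returns_minus)
  then have 0: "0 \<in> returns n" by simp
  have nat: "int m * i \<in> returns n" for m
    by (induction m) (auto simp: 0 distrib_right intro: returns_add i)
  show ?thesis
    using nat[of "nat k"] returns_minus[OF nat[of "nat (- k)"]] by (cases "k \<ge> 0") auto
qed

lemma returns_power: "int r ^ n \<in> returns n"
proof -
  obtain y where y: "y \<in> X" using infinite_shift by fastforce
  have "shift_pow (int r ^ n) (\<Theta> n y) = \<Theta> n (shift_pow 1 y)" by (simp add: \<Theta>_shift)
  moreover have "\<Theta> n y \<in> Y n" "\<Theta> n (shift_pow 1 y) \<in> Y n" using y by auto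
  ultimately have "\<Theta> n y \<in> Y n \<and> shift_pow (int r ^ n) (\<Theta> n y) \<in> Y n" by metis
  then show ?thesis unfolding returns_def by blast
qed

text \<open>The positive generator of the subgroup \<open>returns n\<close>; recognizability amounts
  to its being \<open>r ^ n\<close>.\<close>

definition least_return :: "nat \<Rightarrow> nat" where
  "least_return n = (LEAST d. d > 0 \<and> int d \<in> returns n)"

lemma least_return: "least_return n > 0" "int (least_return n) \<in> returns n"
proof -
  have "r ^ n > 0 \<and> int (r ^ n) \<in> returns n" using returns_power by simp
  then have "least_return n > 0 \<and> int (least_return n) \<in> returns n" unfolding least_return_def by (rule LeastI)
  then show "least_return n > 0" "int (least_return n) \<in> returns n" by auto
qed

lemma returns_iff: "i \<in> returns n \<longleftrightarrow> int (least_return n) dvd i"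
proof
  assume i: "i \<in> returns n"
  define k where "k = nat (i mod int (least_return n))"
  have k: "int k = i mod int (least_return n)" using least_return(1) by (simp add: k_def)
  have "i + (- (i div int (least_return n))) * int (least_return n) \<in> returns n"
    using i least_return(2) by (intro returns_add returns_mult)
  then have kD: "int k \<in> returns n" using k by (simp add: minus_div_mult_eq_mod)
  have "int k < int (least_return n)" using least_return(1)[of n] by (simp add: k)
  then have "k = 0" using kD not_less_Least[of k "\<lambda>d. d > 0 \<and> int d \<in> returns n"] by (auto simp: least_return_def)
  then show "int (least_return n) dvd i" using k by (simp add: dvd_eq_mod_eq_0)
next
  assume "int (least_return n) dvd i"
  then show "i \<in> returns n" using returns_mult[OF least_return(2)] by (auto simp: dvd_def mult.commute)
qed

text \<open>A long repetition of period at most \<open>r\<^sup>n\<close> would contain \<open>\<theta>\<^sup>n(ab)\<close> for all words \<open>ab\<close> of the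
  language and so force the whole shift to be periodic.\<close>

lemma no_high_powers:
  "\<exists>L. \<forall>n q a x. x \<in> X \<longrightarrow> 0 < q \<longrightarrow> q \<le> r ^ n \<longrightarrow>
     \<not> (\<forall>s. a \<le> s \<and> s < a + int L * int r ^ n \<longrightarrow> x s = x (s + int q))"
proof -
  obtain M where M: "\<And>x y i b. x \<in> X \<Longrightarrow> y \<in> X \<Longrightarrow> \<exists>s. b \<le> s \<and> s + int 2 \<le> b + int M \<and>
     (\<forall>t. 0 \<le> t \<and> t < int 2 \<longrightarrow> y (i + t) = x (s + t))"
    using shift_recurrent[of 2] by blast
  have False if x: "x \<in> X" and q: "0 < q" "q \<le> r ^ n" and
    per: "\<And>s. a \<le> s \<Longrightarrow> s < a + int (M + 1) * int r ^ n \<Longrightarrow> x s = x (s + int q)" for x q n a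
  proof -
    define R where "R = int r ^ n"
    have R: "R > 0" by (simp add: R_def)
    have qR: "int q \<le> R" using q(2) by (simp add: R_def flip: of_nat_power)
    obtain p y where y: "y \<in> X" "x = shift_pow (int p) (\<Theta> n y)" using desubstitute[OF x] by blast
    \<comment> \<open>Index of the first block of y whose image starts strictly beyond position a of
      x.\<close>
    define b where "b = (a + int p) div R + 1"
    have "b * R = (a + int p) div R * R + R" by (simp add: b_def distrib_right)
    then have b: "a + int p < b * R" "b * R \<le> a + int p + R"
      using div_mult_mod_eq[of "a + int p" R] pos_mod_bound[OF R, of "a + int p"]
        pos_mod_sign[OF R, of "a + int p"] by linarith+
    have "x' t = x' (t + int q)" if x': "x' \<in> X" for x' t
    proof -
      obtain p' y' where y': "y' \<in> X" "x' = shift_pow (int p') (\<Theta> n y')"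
        using desubstitute[OF x'] by blast
      define b' where "b' = (t + int p') div R"
      define c where "c = (t + int p') mod R"
      have c: "0 \<le> c" "c < R" using R by (simp_all add: c_def)
      have tc: "t + int p' = b' * R + c" by (simp add: b'_def c_def)
      \<comment> \<open>Since q is at most \<open>r ^ n\<close>, the positions t and t + q of x' lie
        under the letters b' and b' + 1 of y'. This two-letter word recurs in y inside the
        repetition, where the comparison can be copied.\<close>
      obtain s where s: "b \<le> s" "s + 2 \<le> b + int M"
          "\<And>t. 0 \<le> t \<Longrightarrow> t < 2 \<Longrightarrow> y' (b' + t) = y (s + t)"
        using M[OF y(1) y'(1), of b b'] by auto
      have copy: "x' (t + j) = x (s * R + c - int p + j)" if "0 \<le> j" "j \<le> R" for j
      proof -
        have cj: "0 \<le> (c + j) div R" "(c + j) div R < 2"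
          using int_div_bounds[of "c + j" 2 R] that c R by simp_all
        have e: "t + j + int p' = c + j + b' * R" "s * R + c - int p + j + int p = c + j + s * R"
          using tc by simp_all
        have "x' (t + j) = G n (y' (b' + (c + j) div R)) (nat ((c + j) mod R))"
          unfolding y'(2) shift_pow_apply e \<Theta>_apply R_def[symmetric] using R by simp
        moreover have "x (s * R + c - int p + j) = G n (y (s + (c + j) div R)) (nat ((c + j) mod R))"
          unfolding y(2) shift_pow_apply e \<Theta>_apply R_def[symmetric] using R by simp
        ultimately show ?thesis using s(3)[OF cj] by simp
      qed
      have "s * R \<ge> b * R" using s(1) R by (simp add: mult_right_mono)
      moreover have "(s + 2) * R \<le> (b + int M) * R" using s(2) R by (intro mult_right_mono) auto
      moreover have "(s + 2) * R = s * R + 2 * R" by (simp add: distrib_right)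
      moreover have "(b + int M) * R = b * R + int M * R" by (simp add: distrib_right)
      moreover have "int (M + 1) * int r ^ n = int M * R + R" unfolding R_def[symmetric] by (simp add: distrib_right)
      ultimately have "a \<le> s * R + c - int p" "s * R + c - int p < a + int (M + 1) * int r ^ n"
        using b c R by linarith+
      then have "x (s * R + c - int p) = x (s * R + c - int p + int q)" by (rule per)
      moreover have "x' (t + 0) = x (s * R + c - int p + 0)" using R by (intro copy) auto
      moreover have "x' (t + int q) = x (s * R + c - int p + int q)" using qR by (intro copy) auto
      ultimately show ?thesis by (simp only: add_0_right)
    qed
    then have "X \<subseteq> {x. \<forall>t. x t = x (t + int q)}" by blast
    then show False using finite_periodic_sequences[OF q(1)] infinite_shift finite_subset by blast
  qed
  then show ?thesis by (intro exI[of _ "M + 1"] allI impI notI) blast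
qed

text \<open>Let d be the least return time. The translates of theta^n(x0) by multiples of d all have
  preimages under theta^n. With more such multiples below \<open>r ^ n\<close> than words of length
  L, two preimages agree on L letters, so theta^n(x0) repeats with a period at most
  \<open>r ^ n\<close> over L r^n positions, against \<open>no_high_powers\<close>.\<close>

lemma ratio_bounded: "\<exists>B. \<forall>n. r ^ n div least_return n \<le> B"
proof -
  obtain L where L: "\<And>n q a x. x \<in> X \<Longrightarrow> 0 < q \<Longrightarrow> q \<le> r ^ n \<Longrightarrow>
     \<not> (\<forall>s. a \<le> s \<and> s < a + int L * int r ^ n \<longrightarrow> x s = x (s + int q))"
    using no_high_powers by blast
  obtain x0 where x0: "x0 \<in> X" using infinite_shift by fastforce
  define W where "W = {xs :: 'a list. set xs \<subseteq> UNIV \<and> length xs = L}"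
  have fin: "finite W" unfolding W_def by (rule finite_lists_length_eq) simp
  have "r ^ n div least_return n \<le> card W" for n
  proof (rule ccontr)
    define e where "e = r ^ n div least_return n"
    assume "\<not> r ^ n div least_return n \<le> card W"
    then have e: "card {..<e} > card W" by (simp add: e_def)
    have "\<exists>x'\<in>X. shift_pow (int (j * least_return n)) (\<Theta> n x0) = \<Theta> n x'" for j
      using returns_all[of "int (j * least_return n)" n "\<Theta> n x0"] x0 by (auto simp: returns_iff)
    then obtain x' where x': "\<And>j. shift_pow (int (j * least_return n)) (\<Theta> n x0) = \<Theta> n (x' j)" by metis
    define w where "w j = map (x' j \<circ> int) [0..<L]" for j
    have "w ` {..<e} \<subseteq> W" by (auto simp: w_def W_def)
    then have "\<not> inj_on w {..<e}" using e fin card_inj_on_le[of w "{..<e}" W] by auto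
    then obtain j k where jk: "j < k" "k < e" "w j = w k"
      unfolding inj_on_def by (metis lessThan_iff linorder_neqE_nat)
    define q where "q = (k - j) * least_return n"
    have "q \<le> e * least_return n" unfolding q_def using jk by (intro mult_le_mono1) auto
    also have "\<dots> \<le> r ^ n" by (simp add: e_def)
    finally have q: "q \<le> r ^ n" "q > 0" using jk(1) least_return(1) by (auto simp: q_def)
    have "\<Theta> n x0 s = \<Theta> n x0 (s + int q)"
      if s: "int (j * least_return n) \<le> s" "s < int (j * least_return n) + int L * int r ^ n" for s
    proof -
      define t where "t = s - int (j * least_return n)"
      have t: "0 \<le> t" "t < int L * int r ^ n" using s by (simp_all add: t_def)
      have b: "0 \<le> t div int r ^ n" "t div int r ^ n < int L"
        using int_div_bounds[OF t] by simp_all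
      have "\<forall>i<L. x' j (int i) = x' k (int i)" using jk(3) by (auto simp: w_def)
      then have "x' j (int (nat (t div int r ^ n))) = x' k (int (nat (t div int r ^ n)))"
        using b by (metis nat_less_iff)
      then have "x' j (t div int r ^ n) = x' k (t div int r ^ n)" using b by simp
      then have "\<Theta> n (x' j) t = \<Theta> n (x' k) t" by (simp add: \<Theta>_apply)
      then have "\<Theta> n x0 (t + int (j * least_return n)) = \<Theta> n x0 (t + int (k * least_return n))"
        by (simp flip: x')
      moreover have "t + int (k * least_return n) = s + int q"
        using jk(1) by (simp add: t_def q_def of_nat_diff algebra_simps)
      moreover have "t + int (j * least_return n) = s" by (simp add: t_def)
      ultimately show ?thesis by metis
    qed
    then show False using L[OF \<Theta>_in_shift[OF x0] q(2,1)] by blast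
  qed
  then show ?thesis by blast
qed

text \<open>If \<open>d\<close> is the least return time to \<open>Y m\<close> and \<open>e = r\<^sup>m / d\<close>, then \<open>\<theta>\<^sup>-\<^sup>m \<circ> \<sigma>\<^sup>d \<circ> \<theta>\<^sup>m\<close> is an
  \<open>e\<close>-th root of \<open>\<sigma>\<close>. When the ratio is the same at \<open>m\<close> and \<open>2 m\<close>, this root moves \<open>Y m\<close> to
  \<open>\<sigma>\<^sup>s (Y m)\<close> with \<open>s e \<equiv> 1\<close> modulo \<open>e\<close>, so \<open>e = 1\<close>.\<close>

lemma least_return_eq: "least_return n = r ^ n"
proof -
  define e where "e n = r ^ n div least_return n" for n
  have dvd: "least_return n dvd r ^ n" for n
    using returns_power[of n] unfolding returns_iff by (metis of_nat_dvd_iff of_nat_power)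
  have e: "r ^ n = e n * least_return n" for n using dvd by (simp add: e_def)
  \<comment> \<open>Applying theta turns the return time d of \<open>Y n\<close> into the return
    time r d of \<open>Y (n + 1)\<close>, so the next least return time divides r d.\<close>
  have "e n \<le> e (Suc n)" for n
  proof -
    obtain x where x: "x \<in> Y n" using Y_nonempty by blast
    have "shift_pow (int (least_return n)) x \<in> Y n" using returns_all[OF least_return(2) x] .
    then have "\<Theta> 1 (shift_pow (int (least_return n)) x) \<in> Y (1 + n)" by (rule \<Theta>_in_Y)
    then have "shift_pow (int (least_return n * r)) (\<Theta> 1 x) \<in> Y (1 + n)" unfolding \<Theta>_shift by simp
    then have "int (least_return n * r) \<in> returns (1 + n)" using \<Theta>_in_Y[OF x, of 1] unfolding returns_def by blast
    then have "least_return (Suc n) dvd least_return n * r" by (simp only: returns_iff of_nat_dvd_iff plus_1_eq_Suc)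
    then have "least_return (Suc n) \<le> least_return n * r" using least_return(1)[of n] by (intro dvd_imp_le) auto
    then have "e (Suc n) * least_return (Suc n) \<le> e (Suc n) * (least_return n * r)" by simp
    then have "r * (e n * least_return n) \<le> r * (e (Suc n) * least_return n)"
      using e[of "Suc n"] e[of n] by (simp add: mult_ac)
    then show ?thesis using least_return(1)[of n] by simp
  qed
  then have mono: "m \<le> n \<Longrightarrow> e m \<le> e n" for m n by (rule lift_Suc_mono_le)
  obtain B where B: "\<And>n. e n \<le> B" using ratio_bounded by (auto simp: e_def)
  then have fin: "finite (range e)" by (intro finite_subset[of "range e" "{..B}"]) auto
  obtain m where m: "e m = Max (range e)" using Max_in[OF fin] by auto
  have max: "e n \<le> e m" for n using fin by (simp add: m)
  \<comment> \<open>A bounded nondecreasing sequence of naturals keeps its maximum once it is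
    attained; this supplies the equal ratios at m and 2 m.\<close>
  have em: "e (m + m) = e m" using max[of "m + m"] mono[of m "m + m"] by simp
  define d where "d = least_return m"
  have e_pos: "e n > 0" for n
  proof -
    have "e n * least_return n > 0" unfolding e[symmetric] by simp
    then show ?thesis by simp
  qed
  have rd: "r ^ m = e m * d" using e[of m] by (simp only: d_def)
  have ri: "int r ^ m = int (e m) * int d" using rd by (metis of_nat_mult of_nat_power)
  have "e m * least_return (m + m) = r ^ (m + m)" using e[of "m + m"] em by simp
  also have "\<dots> = e m * (r ^ m * d)" unfolding power_add by (subst (1) rd) (simp only: mult_ac)
  finally have d2: "least_return (m + m) = r ^ m * d" using e_pos[of m] by simp
  obtain x where x: "x \<in> Y m" using Y_nonempty by blast
  have "shift_pow (int d) (\<Theta> m x) \<in> Y m"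
    using x Y_subset unfolding d_def by (intro returns_all[OF least_return(2)]) auto
  then obtain y where y: "y \<in> X" "shift_pow (int d) (\<Theta> m x) = \<Theta> m y" by auto
  obtain s z where z: "z \<in> X" "y = shift_pow (int s) (\<Theta> m z)" using desubstitute[OF y(1)] by blast
  have "shift_pow (int d - int s * int r ^ m) (\<Theta> m x) = shift_pow (- int s * int r ^ m) (\<Theta> m y)"
    by (simp add: shift_pow_add flip: y(2))
  also have "\<dots> = \<Theta> m (shift_pow (- int s) y)" by (simp only: \<Theta>_shift)
  also have "shift_pow (- int s) y = \<Theta> m z" by (simp add: z(2) shift_pow_add)
  also have "\<Theta> m (\<Theta> m z) \<in> Y (m + m)" using z(1) by (intro \<Theta>_in_Y) auto
  finally have "int d - int s * int r ^ m \<in> returns (m + m)"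
    using \<Theta>_in_Y[OF x, of m] unfolding returns_def by blast
  \<comment> \<open>As r^m = e d, both sides carry a factor d. Cancelling it leaves that e d divides
    1 - s e, so e divides 1.\<close>
  then have "int (r ^ m * d) dvd int d - int s * int r ^ m" by (simp add: returns_iff d2)
  then have "int d * (int (e m) * int d) dvd int d * (1 - int s * int (e m))"
    unfolding ri of_nat_mult of_nat_power by (simp only: algebra_simps mult_1_right mult_1_left)
  then have "int (e m) * int d dvd 1 - int s * int (e m)"
    using least_return(1)[of m] by (simp add: d_def)
  then have "int (e m) dvd 1 - int s * int (e m)" using dvd_mult_left by blast
  then have "int (e m) dvd (1 - int s * int (e m)) + int s * int (e m)"
    by (rule dvd_add) simp
  then have "int (e m) dvd 1" by simp
  then have "e m = 1" by simp
  then have "e n = 1" using max[of n] e_pos[of n] by simp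
  then show ?thesis using e[of n] by simp
qed

text \<open>This makes the phase of a point modulo \<open>r ^ n\<close> unique, and thereby lets the
  definite descriptions in \<open>mef_map\<close> and \<open>kappa\<close> denote.\<close>

theorem recognizability: "x \<in> Y n \<Longrightarrow> shift_pow i x \<in> Y n \<longleftrightarrow> int r ^ n dvd i"
  using returns_iff[of i n] returns_all[of i n x] least_return_eq[of n] by (auto simp: returns_def)

end

section \<open>The rotation number of an endomorphism\<close>

lemma radic_res_less: "radic_res r z n < r ^ n" if "z \<in> radic_integers r"
proof (induction n)
  case (Suc n)
  have "z n * r ^ n + radic_res r z n < Suc (z n) * r ^ n" using Suc by simp
  also have "\<dots> \<le> r * r ^ n" using that by (intro mult_le_mono1) (auto simp: radic_integers_def Suc_leI)
  finally show ?case by (simp add: radic_res_def)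
qed (simp add: radic_res_def)

lemma radic_res_mod: "radic_res r z (n + m) mod r ^ n = radic_res r z n"
  if "z \<in> radic_integers r"
proof -
  have "radic_res r z (n + m) = radic_res r z n + r ^ n * (\<Sum>i<m. z (n + i) * r ^ i)"
    unfolding radic_res_def
    by (induction m) (auto simp: power_add algebra_simps)
  then show ?thesis using radic_res_less[OF that, of n] by simp
qed

lemma radic_eqI: "z = z'"
  if "z \<in> radic_integers r" "z' \<in> radic_integers r" "r > 0" "\<And>n. radic_res r z n = radic_res r z' n"
proof
  fix n
  have "z n * r ^ n = z' n * r ^ n"
    using that(4)[of "Suc n"] that(4)[of n] by (simp add: radic_res_def)
  then show "z n = z' n" using that(3) by simp
qed

lemma radic_of_residues_in: "radic_of_residues r R \<in> radic_integers r" if "r > 0"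
proof -
  have "R (Suc n) mod r ^ Suc n < r * r ^ n" for n using that by simp
  then show ?thesis
    unfolding radic_integers_def radic_of_residues_def
    by (auto intro: less_mult_imp_div_less)
qed

lemma radic_res_add:
  "radic_res r (radic_add r x y) n = (radic_res r x n + radic_res r y n) mod r ^ n"
  if "x \<in> radic_integers r" "y \<in> radic_integers r"
  unfolding radic_add_def
proof (rule radic_res_of_residues)
  fix n
  show "(radic_res r x (Suc n) + radic_res r y (Suc n)) mod r ^ n =
      (radic_res r x n + radic_res r y n) mod r ^ n"
    using radic_res_mod[OF that(1), of n 1] radic_res_mod[OF that(2), of n 1]
    by (metis Suc_eq_plus1 mod_add_eq)
qed

lemma radic_res_mult:
  "radic_res r (radic_mult r x y) n = (radic_res r x n * radic_res r y n) mod r ^ n"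
  if "x \<in> radic_integers r" "y \<in> radic_integers r"
  unfolding radic_mult_def
proof (rule radic_res_of_residues)
  fix n
  show "(radic_res r x (Suc n) * radic_res r y (Suc n)) mod r ^ n =
      (radic_res r x n * radic_res r y n) mod r ^ n"
    using radic_res_mod[OF that(1), of n 1] radic_res_mod[OF that(2), of n 1]
    by (metis Suc_eq_plus1 mod_mult_eq)
qed

lemma radic_res_of_int: "int (radic_res r (radic_of_int r k) n) = k mod int r ^ n" if "r > 0"
proof -
  have nonneg: "k mod int r ^ n \<ge> 0" for n using that by simp
  have "nat (k mod int r ^ Suc n) mod r ^ n = nat (k mod int r ^ n) mod r ^ n" for n
  proof -
    have "int (nat (k mod int r ^ Suc n) mod r ^ n) = k mod int r ^ Suc n mod int r ^ n"
      using nonneg[of "Suc n"] by (simp add: zmod_int)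
    also have "\<dots> = k mod int r ^ n" by (rule mod_mod_cancel) simp
    also have "\<dots> = k mod int r ^ n mod int r ^ n" by simp
    also have "\<dots> = int (nat (k mod int r ^ n) mod r ^ n)"
      using nonneg[of n] by (simp add: zmod_int)
    finally show ?thesis by (rule of_nat_eq_iff[THEN iffD1])
  qed
  then have "radic_res r (radic_of_int r k) n = nat (k mod int r ^ n) mod r ^ n"
    unfolding radic_of_int_def by (rule radic_res_of_residues)
  also have "int \<dots> = k mod int r ^ n" using nonneg[of n] by (simp add: zmod_int)
  finally show ?thesis .
qed

lemma dvd_diff_less_eq: "i = j" if "int m dvd int i - int j" "i < m" "j < m"
proof -
  have "int i mod int m = int j mod int m" using that(1) by (simp add: mod_eq_dvd_iff)
  then show ?thesis using that(2,3) by simp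
qed

context aperiodic_substitution
begin

section \<open>Phases modulo r^n, the factor map and the rotation number\<close>

lemma phase_unique: "int r ^ n dvd i - j"
  if "shift_pow (- i) x \<in> Y n" "shift_pow (- j) x \<in> Y n"
  using recognizability[OF that(1), of "i - j"] that(2) by (simp add: shift_pow_add)

lemma phase_cong: "shift_pow (- j) x \<in> Y n"
  if "shift_pow (- i) x \<in> Y n" "int r ^ n dvd i - j"
  using recognizability[OF that(1), of "i - j"] that(2) by (simp add: shift_pow_add)

lemma phase_exists: "\<exists>p<r ^ n. shift_pow (- int p) x \<in> Y n" if x: "x \<in> X"
proof -
  obtain p y where "p < r ^ n" "y \<in> X" "x = shift_pow (int p) (\<Theta> n y)"
    using desubstitute[OF x] by blast
  then show ?thesis by (auto simp: shift_pow_add)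
qed

lemma phase_mono: "shift_pow i x \<in> Y (Suc n) \<Longrightarrow> shift_pow i x \<in> Y n"
  using Y_antimono[of _ n 1] by simp

lemma shift_image_iff: "x \<in> shift_pow i ` Y n \<longleftrightarrow> shift_pow (- i) x \<in> Y n"
proof
  assume "shift_pow (- i) x \<in> Y n"
  moreover have "x = shift_pow i (shift_pow (- i) x)" by (simp add: shift_pow_add)
  ultimately show "x \<in> shift_pow i ` Y n" by blast
next
  assume "x \<in> shift_pow i ` Y n"
  then obtain y where "y \<in> Y n" "x = shift_pow i y" by blast
  then show "shift_pow (- i) x \<in> Y n" by (simp add: shift_pow_add)
qed

text \<open>The description in \<open>mef_map\<close> is an equivalence over all i. By uniqueness of
  phases, exhibiting one correct phase for each n already gives both directions.\<close>

lemma mef_map_eqI: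
  assumes x: "x \<in> X" and z: "z \<in> radic_integers r"
    and phase: "\<And>n. shift_pow (- int (radic_res r z n)) x \<in> Y n"
  shows "mef_map r \<theta> x = z"
  unfolding mef_map_def shift_image_iff
proof (rule the_equality)
  have "radic_res r z n = i \<longleftrightarrow> shift_pow (- int i) x \<in> Y n" if "i < r ^ n" for i n
  proof
    show "shift_pow (- int i) x \<in> Y n" if "radic_res r z n = i" using phase[of n] that by simp
    assume "shift_pow (- int i) x \<in> Y n"
    from phase_unique[OF phase this] have "int (r ^ n) dvd int (radic_res r z n) - int i" by simp
    then show "radic_res r z n = i" using radic_res_less[OF z] that by (rule dvd_diff_less_eq)
  qed
  then show "z \<in> radic_integers r \<and>
      (\<forall>n. \<forall>i<r ^ n. (radic_res r z n = i) = (shift_pow (- int i) x \<in> Y n))"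
    using z by blast
next
  fix z'
  assume z': "z' \<in> radic_integers r \<and>
      (\<forall>n. \<forall>i<r ^ n. (radic_res r z' n = i) = (shift_pow (- int i) x \<in> Y n))"
  show "z' = z"
  proof (rule radic_eqI)
    show "radic_res r z' n = radic_res r z n" for n
      using z' phase[of n] radic_res_less[OF z, of n] by blast
  qed (use z z' in simp_all)
qed

lemma radic_of_phases:
  assumes "\<And>n. s n < r ^ n" "\<And>n. int r ^ n dvd int (s (Suc n)) - int (s n)"
  shows "\<exists>z\<in>radic_integers r. \<forall>n. radic_res r z n = s n"
proof -
  have "s (Suc n) mod r ^ n = s n mod r ^ n" for n
    using assms(2)[of n] by (metis mod_eq_dvd_iff of_nat_eq_iff of_nat_mod of_nat_power)
  then have "radic_res r (radic_of_residues r s) n = s n mod r ^ n" for n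
    by (rule radic_res_of_residues)
  then show ?thesis using assms(1) radic_of_residues_in[of r s] by (auto intro!: bexI[of _ "radic_of_residues r s"])
qed

lemma mef_map:
  assumes x: "x \<in> X"
  shows "mef_map r \<theta> x \<in> radic_integers r"
    and "shift_pow (- int (radic_res r (mef_map r \<theta> x) n)) x \<in> Y n"
proof -
  obtain s where s: "\<And>n. s n < r ^ n" "\<And>n. shift_pow (- int (s n)) x \<in> Y n"
    using phase_exists[OF x] by metis
  have "int r ^ n dvd int (s (Suc n)) - int (s n)" for n
    using phase_unique[OF phase_mono[OF s(2)[of "Suc n"]] s(2)[of n]] .
  then obtain z where z: "z \<in> radic_integers r" "\<And>n. radic_res r z n = s n"
    using radic_of_phases[OF s(1)] by blast
  then have "mef_map r \<theta> x = z" using s(2) by (intro mef_map_eqI[OF x]) simp_all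
  then show "mef_map r \<theta> x \<in> radic_integers r"
    "shift_pow (- int (radic_res r (mef_map r \<theta> x) n)) x \<in> Y n" using z s(2)[of n] by simp_all
qed

text \<open>The phase s is read off at one point of \<open>Y n\<close>. Then sigma^(-s) composed
  with \<Phi> sends that point into \<open>Y n\<close>, hence all of \<open>Y n\<close> by
  \<open>endo_maps_Y\<close>. The nesting of the sets \<open>Y n\<close> makes the phases
  coherent.\<close>

lemma endo_rotation_exists:
  assumes "endo \<Phi>"
  shows "\<exists>z\<in>radic_integers r. \<forall>n. \<forall>x\<in>Y n. shift_pow (- int (radic_res r z n)) (\<Phi> x) \<in> Y n"
proof -
  have "\<exists>s<r ^ n. \<forall>x\<in>Y n. shift_pow (- int s) (\<Phi> x) \<in> Y n" for n
  proof -
    obtain x0 where x0: "x0 \<in> Y n" using Y_nonempty by blast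
    obtain s where s: "s < r ^ n" "shift_pow (- int s) (\<Phi> x0) \<in> Y n"
      using phase_exists[OF endo_in[OF assms Y_subset[OF x0]]] by blast
    have "endo (\<lambda>x. shift_pow (- int s) (\<Phi> x))"
      by (rule endo_comp[OF endo_shift_pow assms])
    then show ?thesis using endo_maps_Y x0 s by blast
  qed
  then obtain s where s: "\<And>n. s n < r ^ n" "\<And>n x. x \<in> Y n \<Longrightarrow> shift_pow (- int (s n)) (\<Phi> x) \<in> Y n"
    by metis
  have "int r ^ n dvd int (s (Suc n)) - int (s n)" for n
  proof -
    obtain x where x: "x \<in> Y (Suc n)" using Y_nonempty by blast
    have "x \<in> Y n" using phase_mono[of 0 x n] x by simp
    then show ?thesis using phase_unique[OF phase_mono[OF s(2)[OF x]] s(2)] by blast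
  qed
  then obtain z where z: "z \<in> radic_integers r" "\<And>n. radic_res r z n = s n"
    using radic_of_phases[OF s(1)] by blast
  have "\<forall>n. \<forall>x\<in>Y n. shift_pow (- int (radic_res r z n)) (\<Phi> x) \<in> Y n"
    unfolding z(2) using s(2) by blast
  then show ?thesis using z(1) by blast
qed

text \<open>Turns the definite description into the usable form that sigma^(-s) \<Phi> preserves
  \<open>Y n\<close>, where s is the residue of \<open>kappa\<close>. A general point is first moved
  into \<open>Y n\<close> by its own phase; for uniqueness, one point suffices, since its residue
  cancels.\<close>

lemma kappa:
  assumes "endo \<Phi>"
  shows "kappa r \<theta> \<Phi> \<in> radic_integers r"
    and "x \<in> Y n \<Longrightarrow> shift_pow (- int (radic_res r (kappa r \<theta> \<Phi>) n)) (\<Phi> x) \<in> Y n"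
proof -
  obtain z where z: "z \<in> radic_integers r"
    and phase: "\<And>n x. x \<in> Y n \<Longrightarrow> shift_pow (- int (radic_res r z n)) (\<Phi> x) \<in> Y n"
    using endo_rotation_exists[OF assms] by blast
  have add_in: "radic_add r a b \<in> radic_integers r" for a b
    unfolding radic_add_def by (rule radic_of_residues_in) simp
  have "mef_map r \<theta> (\<Phi> x) = radic_add r z (mef_map r \<theta> x)" if x: "x \<in> X" for x
  proof (rule mef_map_eqI)
    show "\<Phi> x \<in> X" using endo_in[OF assms x] .
    show "radic_add r z (mef_map r \<theta> x) \<in> radic_integers r" by (rule add_in)
    fix n
    define a where "a = radic_res r (mef_map r \<theta> x) n"
    have "shift_pow (- int (radic_res r z n)) (\<Phi> (shift_pow (- int a) x)) \<in> Y n"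
      using mef_map(2)[OF x, of n] unfolding a_def by (rule phase)
    then have "shift_pow (- (int (radic_res r z n) + int a)) (\<Phi> x) \<in> Y n"
      by (simp add: endo_shift[OF assms x] shift_pow_add)
    moreover have "int r ^ n dvd int (radic_res r z n) + int a - int ((radic_res r z n + a) mod r ^ n)"
      by (metis dvd_minus_mod of_nat_add of_nat_mod of_nat_power)
    ultimately have "shift_pow (- int ((radic_res r z n + a) mod r ^ n)) (\<Phi> x) \<in> Y n"
      by (rule phase_cong)
    then show "shift_pow (- int (radic_res r (radic_add r z (mef_map r \<theta> x)) n)) (\<Phi> x) \<in> Y n"
      by (simp add: radic_res_add[OF z mef_map(1)[OF x]] a_def)
  qed
  moreover have "z' = z" if z': "z' \<in> radic_integers r"
    and eq: "\<And>x. x \<in> X \<Longrightarrow> mef_map r \<theta> (\<Phi> x) = radic_add r z' (mef_map r \<theta> x)" for z'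
  proof (rule radic_eqI[OF z' z r_pos(1)])
    fix n
    obtain x where x: "x \<in> X" using infinite_shift by fastforce
    have "radic_add r z' (mef_map r \<theta> x) = radic_add r z (mef_map r \<theta> x)"
      using eq[OF x] calculation[OF x] by simp
    then have "(radic_res r z' n + radic_res r (mef_map r \<theta> x) n) mod r ^ n =
        (radic_res r z n + radic_res r (mef_map r \<theta> x) n) mod r ^ n"
      using radic_res_add[OF z mef_map(1)[OF x], of n] radic_res_add[OF z' mef_map(1)[OF x], of n] by simp
    then have "(int (radic_res r z' n) + int (radic_res r (mef_map r \<theta> x) n)) mod int (r ^ n) =
        (int (radic_res r z n) + int (radic_res r (mef_map r \<theta> x) n)) mod int (r ^ n)"
      unfolding of_nat_add[symmetric] of_nat_mod[symmetric] by (rule arg_cong)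
    then have "int (r ^ n) dvd int (radic_res r z' n) - int (radic_res r z n)"
      unfolding mod_eq_dvd_iff by (simp only: add_diff_cancel_right)
    then show "radic_res r z' n = radic_res r z n"
      using radic_res_less[OF z'] radic_res_less[OF z] by (rule dvd_diff_less_eq)
  qed
  ultimately have "kappa r \<theta> \<Phi> = z"
    unfolding kappa_def using z by (intro the_equality) blast+
  then show "kappa r \<theta> \<Phi> \<in> radic_integers r"
    and "x \<in> Y n \<Longrightarrow> shift_pow (- int (radic_res r (kappa r \<theta> \<Phi>) n)) (\<Phi> x) \<in> Y n"
    using z phase by simp_all
qed

section \<open>Automorphisms are block maps\<close>

definition cyl :: "(int \<Rightarrow> 'a) \<Rightarrow> nat \<Rightarrow> (int \<Rightarrow> 'a) set" where
  "cyl x R = {y. \<forall>t. \<bar>t\<bar> \<le> int R \<longrightarrow> y t = x t}"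

abbreviation full_top :: "(int \<Rightarrow> 'a) topology" where
  "full_top \<equiv> product_topology (\<lambda>_. discrete_topology UNIV) UNIV"

lemma openin_cyl: "openin full_top (cyl x R)"
proof -
  let ?U = "\<lambda>t. if \<bar>t\<bar> \<le> int R then {x t} else UNIV"
  have eq: "cyl x R = PiE UNIV ?U" by (auto simp: cyl_def PiE_def Pi_def split: if_splits)
  have "{t :: int. \<bar>t\<bar> \<le> int R} \<subseteq> {- int R..int R}" by auto
  then have "finite {t :: int. \<bar>t\<bar> \<le> int R}" by (rule finite_subset) simp
  then have "finite {i. ?U i \<noteq> UNIV}" by (rule rev_finite_subset) auto
  then show ?thesis unfolding eq by (subst openin_PiE_gen) auto
qed

lemma open_contains_cyl:
  assumes "openin full_top U" "x \<in> U"
  shows "\<exists>R. cyl x R \<subseteq> U"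
proof -
  obtain V where V: "finite {i. V i \<noteq> UNIV}" "x \<in> PiE UNIV V" "PiE UNIV V \<subseteq> U"
    using assms by (auto simp: openin_product_topology_alt)
  define F where "F = {i. V i \<noteq> UNIV}"
  define R where "R = (\<Sum>i\<in>F. nat \<bar>i\<bar>)"
  have "cyl x R \<subseteq> PiE UNIV V"
  proof
    fix y assume y: "y \<in> cyl x R"
    have "y i \<in> V i" for i
    proof (cases "i \<in> F")
      case True
      then have "nat \<bar>i\<bar> \<le> R" unfolding R_def using V(1) by (intro member_le_sum) (auto simp: F_def)
      then have "y i = x i" using y by (simp add: cyl_def)
      then show ?thesis using V(2) by auto
    qed (auto simp: F_def)
    then show "y \<in> PiE UNIV V" by auto
  qed
  then show ?thesis using V(3) by blast
qed

text \<open>The complement is open because a word outside the language is visible in a finite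
  window; the full shift is compact by Tychonoff.\<close>

lemma compactin_shift: "compactin full_top X"
proof -
  have "openin full_top (topspace full_top - X)"
  proof (subst openin_subopen, intro ballI)
    fix x assume "x \<in> topspace full_top - X"
    then obtain i n where n: "\<not> occ n (\<lambda>t. x (i + int t))" by (auto simp: shift_iff)
    define R where "R = nat \<bar>i\<bar> + n"
    have "y \<notin> X" if y: "y \<in> cyl x R" for y
    proof -
      have "y (i + int t) = x (i + int t)" if "t < n" for t
        using y that by (simp add: cyl_def R_def)
      then show ?thesis using n occ_cong[of n "\<lambda>t. y (i + int t)" "\<lambda>t. x (i + int t)"] occ_shift[of y n i] by auto
    qed
    then show "\<exists>T. openin full_top T \<and> x \<in> T \<and> T \<subseteq> topspace full_top - X"
      using openin_cyl[of x R] by (intro exI[of _ "cyl x R"]) (auto simp: cyl_def)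
  qed
  then have "closedin full_top X" by (simp add: closedin_def)
  moreover have "compact_space full_top"
    by (auto simp: compact_space_product_topology compact_space_discrete_topology)
  ultimately show ?thesis by (simp add: closedin_compact_space)
qed

text \<open>The Curtis-Hedlund-Lyndon argument: coordinate 0 of \<Phi> takes values in a discrete
  space, so it is locally constant; compactness makes the radius uniform, and commutation with all
  integer shifts moves the rule to every coordinate.\<close>

lemma endo_of_Aut:
  assumes "\<Phi> \<in> shift_Aut r \<theta>"
  shows "endo \<Phi>"
proof -
  have tops: "topspace (subst_shift_top r \<theta>) = X" by (simp add: subst_shift_top_def)
  have cont: "continuous_map (subst_shift_top r \<theta>) (subst_shift_top r \<theta>) \<Phi>"
    and comm: "\<And>x. x \<in> X \<Longrightarrow> \<Phi> (shift x) = shift (\<Phi> x)"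
    using assms by (auto simp: shift_Aut_def homeomorphic_imp_continuous_map)
  have into: "\<Phi> x \<in> X" if "x \<in> X" for x
    using continuous_map_image_subset_topspace[OF cont] that by (auto simp: tops)
  have comm_nat: "\<Phi> (shift_pow (int n) x) = shift_pow (int n) (\<Phi> x)" if "x \<in> X" for n x
  proof (induction n)
    case (Suc n)
    have "\<Phi> (shift_pow (int (Suc n)) x) = \<Phi> (shift (shift_pow (int n) x))"
      by (simp add: shift_pow_add)
    also have "\<dots> = shift (\<Phi> (shift_pow (int n) x))" using that by (intro comm) simp
    also have "\<dots> = shift_pow (int (Suc n)) (\<Phi> x)" by (simp only: Suc shift_pow_add) simp
    finally show ?case .
  qed simp
  \<comment> \<open>Commutation is given for the shift by 1 on points of X; negative powers follow
    by applying the positive case to \<open>shift_pow m x\<close>, which is again in X.\<close>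
  have comm_int: "\<Phi> (shift_pow m x) = shift_pow m (\<Phi> x)" if x: "x \<in> X" for m x
  proof (cases "m \<ge> 0")
    case True
    then show ?thesis using comm_nat[OF x, of "nat m"] by simp
  next
    case False
    have "\<Phi> (shift_pow (int (nat (- m))) (shift_pow m x)) = shift_pow (int (nat (- m))) (\<Phi> (shift_pow m x))"
      using x by (intro comm_nat) simp
    then have "\<Phi> x = shift_pow (- m) (\<Phi> (shift_pow m x))" using False by (simp add: shift_pow_add)
    then have "shift_pow m (\<Phi> x) = shift_pow m (shift_pow (- m) (\<Phi> (shift_pow m x)))" by simp
    then show ?thesis by (simp add: shift_pow_add)
  qed
  have "continuous_map (subst_shift_top r \<theta>) full_top \<Phi>"
    using cont by (simp add: subst_shift_top_def continuous_map_in_subtopology)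
  then have "continuous_map (subst_shift_top r \<theta>) (discrete_topology UNIV) ((\<lambda>x. x 0) \<circ> \<Phi>)"
    by (rule continuous_map_compose) (rule continuous_map_product_projection, simp)
  then have open0: "openin (subst_shift_top r \<theta>) {y \<in> X. \<Phi> y 0 \<in> A}" for A
    unfolding continuous_map_def by (simp add: tops)
  have "\<exists>R. \<forall>y\<in>X. y \<in> cyl x R \<longrightarrow> \<Phi> y 0 = \<Phi> x 0" if x: "x \<in> X" for x
  proof -
    obtain U where U: "openin full_top U" "{y \<in> X. \<Phi> y 0 \<in> {\<Phi> x 0}} = U \<inter> X"
      using open0[of "{\<Phi> x 0}"] by (auto simp: subst_shift_top_def openin_subtopology)
    then have "x \<in> U" using x by blast
    then obtain R where "cyl x R \<subseteq> U" using open_contains_cyl[OF U(1)] by blast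
    then show ?thesis using U(2) by blast
  qed
  then obtain R where R: "\<And>x y. x \<in> X \<Longrightarrow> y \<in> X \<Longrightarrow> y \<in> cyl x (R x) \<Longrightarrow> \<Phi> y 0 = \<Phi> x 0"
    by metis
  have "\<exists>\<F>. finite \<F> \<and> \<F> \<subseteq> (\<lambda>x. cyl x (R x)) ` X \<and> X \<subseteq> \<Union>\<F>"
  proof (rule compactinD[OF compactin_shift])
    show "X \<subseteq> \<Union> ((\<lambda>x. cyl x (R x)) ` X)" by (auto simp: cyl_def)
  qed (auto intro: openin_cyl)
  then obtain \<F> where \<F>: "finite \<F>" "\<F> \<subseteq> (\<lambda>x. cyl x (R x)) ` X" "X \<subseteq> \<Union>\<F>"
    by blast
  obtain F where F: "F \<subseteq> X" "finite F" "X \<subseteq> (\<Union>x\<in>F. cyl x (R x))"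
    using finite_subset_image[OF \<F>(1,2)] \<F>(3) by blast
  define N where "N = (\<Sum>x\<in>F. R x)"
  have zero: "\<Phi> x 0 = \<Phi> y 0" if xy: "x \<in> X" "y \<in> X" and eq: "\<And>t. \<bar>t\<bar> \<le> int N \<Longrightarrow> x t = y t" for x y
  proof -
    obtain z where z: "z \<in> F" "x \<in> cyl z (R z)" using F(3) xy(1) by blast
    have "R z \<le> N" unfolding N_def using F(2) z(1) by (intro member_le_sum) auto
    then have le: "\<bar>t\<bar> \<le> int N" if "\<bar>t\<bar> \<le> int (R z)" for t using that by linarith
    have y: "y \<in> cyl z (R z)"
      unfolding cyl_def
    proof (intro CollectI allI impI)
      fix t assume t: "\<bar>t\<bar> \<le> int (R z)"
      have "y t = x t" using eq[OF le[OF t]] ..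
      also have "x t = z t" using z(2) t unfolding cyl_def by blast
      finally show "y t = z t" .
    qed
    have zX: "z \<in> X" using z(1) F(1) by blast
    have "\<Phi> x 0 = \<Phi> z 0" "\<Phi> y 0 = \<Phi> z 0"
      using R[OF zX xy(1) z(2)] R[OF zX xy(2) y] .
    then show ?thesis by (rule trans[OF _ sym])
  qed
  have "radius_rule X \<Phi> N"
    unfolding radius_rule_def
  proof (intro ballI allI impI)
    fix x y i j assume x: "x \<in> X" and y: "y \<in> X" and eq: "\<forall>t. \<bar>t\<bar> \<le> int N \<longrightarrow> x (i + t) = y (j + t)"
    have "\<Phi> (shift_pow i x) 0 = \<Phi> (shift_pow j y) 0"
    proof (rule zero)
      show "shift_pow i x t = shift_pow j y t" if "\<bar>t\<bar> \<le> int N" for t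
        using eq that by (simp add: add.commute[of t])
    qed (use x y in simp_all)
    then show "\<Phi> x i = \<Phi> y j" by (simp add: comm_int x y)
  qed
  then show ?thesis using into by (auto simp: endo_def)
qed

end

section \<open>Renormalization\<close>

text \<open>So 1 - r^p is a unit modulo every \<open>r ^ n\<close>, and a congruence for z (1 - r^p)
  determines the residues of z.\<close>

lemma coprime_power_one_minus: "coprime (int r ^ n) (1 - int r ^ p)" if "p \<ge> 1"
proof -
  have "coprime (int r) (1 - int r ^ p)"
  proof (rule coprimeI)
    fix d assume d: "d dvd int r" "d dvd 1 - int r ^ p"
    have "int r dvd int r ^ p" using that by (simp add: dvd_power)
    then have "d dvd 1 - int r ^ p + int r ^ p" using d by (intro dvd_add) (auto dest: dvd_trans)
    then show "is_unit d" by simp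
  qed
  then show ?thesis by simp
qed

text \<open>With k the value of the first p digits, periodicity reads z = k + r^p z, that is z (1 -
  r^p) = k. The values k = 0 and k = r^p - 1 give z = 0 and z = -1; all others lie strictly in
  between.\<close>

lemma radic_periodic_cases:
  assumes z: "z \<in> radic_integers r" and r: "r \<ge> 2" and "radic_periodic z"
  obtains p k where "p \<ge> 1" "0 \<le> k" "k < int r ^ p"
    "\<And>n. int r ^ n dvd int (radic_res r z n) * (1 - int r ^ p) - k"
    "k = 0 \<Longrightarrow> z \<in> range (radic_of_int r)" "k = int r ^ p - 1 \<Longrightarrow> z \<in> range (radic_of_int r)"
proof -
  obtain p where p: "p \<ge> 1" "\<And>n. z (n + p) = z n" using assms(3) by (auto simp: radic_periodic_def)
  define k where "k = int (radic_res r z p)"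
  have step: "radic_res r z (n + p) = radic_res r z p + r ^ p * radic_res r z n" for n
  proof (induction n)
    case (Suc n)
    then show ?case using p(2)[of n] by (simp add: radic_res_def power_add algebra_simps)
  qed (simp add: radic_res_def)
  have quot: "int r ^ n dvd int (radic_res r z n) * (1 - int r ^ p) - k" for n
  proof -
    have "int (radic_res r z (n + p)) mod int r ^ n = int (radic_res r z n)"
      using radic_res_mod[OF z, of n p] by (metis of_nat_mod of_nat_power)
    then have "int r ^ n dvd int (radic_res r z (n + p)) - int (radic_res r z n)"
      by (metis dvd_minus_mod)
    then have "int r ^ n dvd - (int (radic_res r z (n + p)) - int (radic_res r z n))"
      by (simp only: dvd_minus_iff)
    moreover have "- (int (radic_res r z (n + p)) - int (radic_res r z n)) =
        int (radic_res r z n) * (1 - int r ^ p) - k"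
      unfolding step by (simp add: k_def algebra_simps)
    ultimately show ?thesis by simp
  qed
  have of_int: "z \<in> range (radic_of_int r)"
    if "\<And>n. int r ^ n dvd (int (radic_res r z n) - i) * (1 - int r ^ p)" for i
  proof -
    have "z = radic_of_int r i"
    proof (rule radic_eqI[OF z])
      show "radic_of_int r i \<in> radic_integers r"
        unfolding radic_of_int_def using r by (intro radic_of_residues_in) simp
      show "radic_res r z n = radic_res r (radic_of_int r i) n" for n
      proof -
        have "int r ^ n dvd int (radic_res r z n) - i"
          using that[of n] coprime_power_one_minus[OF p(1), of r n] by (simp add: coprime_dvd_mult_left_iff)
        then have "int (radic_res r z n) mod int r ^ n = i mod int r ^ n" by (simp add: mod_eq_dvd_iff)
        moreover have "int (radic_res r z n) mod int r ^ n = int (radic_res r z n)"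
          using radic_res_less[OF z, of n] by (simp flip: of_nat_power)
        ultimately have "int (radic_res r z n) = int (radic_res r (radic_of_int r i) n)"
          using radic_res_of_int[of r i n] r by simp
        then show ?thesis by simp
      qed
    qed (use r in simp)
    then show ?thesis by blast
  qed
  show thesis
  proof (rule that[OF p(1) _ _ quot])
    show "0 \<le> k" by (simp add: k_def)
    show "k < int r ^ p" using radic_res_less[OF z, of p] unfolding k_def by (metis of_nat_less_iff of_nat_power)
    show "z \<in> range (radic_of_int r)" if "k = 0"
      using quot that by (intro of_int[of 0]) simp
    show "z \<in> range (radic_of_int r)" if "k = int r ^ p - 1"
    proof (rule of_int[of "- 1"])
      show "int r ^ n dvd (int (radic_res r z n) - - 1) * (1 - int r ^ p)" for n
        using quot[of n] unfolding that by (simp add: algebra_simps)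
    qed
  qed
qed

text \<open>The rule picks some value that \<Phi> takes at an occurrence of the word, which the
  hypothesis makes unambiguous. Words that do not occur receive an arbitrary letter.\<close>

lemma block_mapI:
  assumes "\<And>x y i j. x \<in> A \<Longrightarrow> y \<in> A \<Longrightarrow>
    (\<And>u. - int l \<le> u \<Longrightarrow> u \<le> int m \<Longrightarrow> x (i + u) = y (j + u)) \<Longrightarrow> \<Phi> x i = \<Phi> y j"
  shows "block_map A \<Phi> l m"
proof -
  let ?w = "\<lambda>x n. map x [n - int l..n + int m]"
  define P where "P w a \<longleftrightarrow> (\<exists>x\<in>A. \<exists>n. ?w x n = w \<and> \<Phi> x n = a)" for w a
  have nth: "?w x n ! nat (u + int l) = x (n + u)" if "- int l \<le> u" "u \<le> int m" for x :: "int \<Rightarrow> 'a" and n u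
    using that by (simp add: nth_upto)
  have "\<Phi> x n = (SOME a. P (?w x n) a)" if x: "x \<in> A" for x n
  proof -
    have "P (?w x n) (\<Phi> x n)" using x by (auto simp: P_def)
    then have "P (?w x n) (SOME a. P (?w x n) a)" by (rule someI)
    then obtain y j where y: "y \<in> A" "?w y j = ?w x n" "\<Phi> y j = (SOME a. P (?w x n) a)"
      by (auto simp: P_def)
    have "\<Phi> y j = \<Phi> x n"
    proof (rule assms[OF y(1) x])
      show "y (j + u) = x (n + u)" if "- int l \<le> u" "u \<le> int m" for u
        using nth[OF that, of y j] nth[OF that, of x n] y(2) by simp
    qed
    then show ?thesis using y(3) by simp
  qed
  then show ?thesis unfolding block_map_def by (intro exI[of _ "\<lambda>w. SOME a. P w a"]) blast
qed

lemma radii_le: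
  assumes "block_map A \<Phi> l m"
  shows "left_radius A \<Phi> \<le> l" "right_radius A \<Phi> \<le> m"
  unfolding left_radius_def right_radius_def using assms by (auto intro: Least_le)

context aperiodic_substitution
begin

lemma column_number_attained:
  obtains ks where "set ks \<subseteq> {..<r}" "card (range (column_comp \<theta> ks)) = column_number r \<theta>"
proof -
  define S where "S = {card (range (column_comp \<theta> ks)) | ks. ks \<noteq> [] \<and> set ks \<subseteq> {..<r}}"
  have "S \<subseteq> {..card (UNIV :: 'a set)}" by (auto simp: S_def intro: card_mono)
  then have fin: "finite S" by (rule finite_subset) simp
  have "card (range (column_comp \<theta> [0])) \<in> S"
    unfolding S_def by (rule CollectI, rule exI[of _ "[0]"]) simp
  then have "Min S \<in> S" using fin by (intro Min_in) auto
  moreover have "column_number r \<theta> = Min S" unfolding column_number_def S_def ..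
  ultimately have "column_number r \<theta> \<in> S" by simp
  then obtain ks where "column_number r \<theta> = card (range (column_comp \<theta> ks))" "set ks \<subseteq> {..<r}"
    unfolding S_def by blast
  then show thesis by (intro that) simp_all
qed

text \<open>This bounds a fibre of the factor map on a finite window. A column of theta^m with the
  smallest image leaves c letters for one position j; applying theta^q stretches that letter over
  the whole window, so a point of the right phase shows one of c words.\<close>

lemma few_windows:
  "\<exists>n i W. finite W \<and> card W \<le> column_number r \<theta> \<and>
     (\<forall>x. shift_pow (- i) x \<in> Y n \<longrightarrow> map x [- int L..int L] \<in> W)"
proof -
  obtain ks where ks: "set ks \<subseteq> {..<r}" "card (range (column_comp \<theta> ks)) = column_number r \<theta>"
    using column_number_attained .
  define m where "m = length ks"
  obtain j where j: "j < r ^ m" "\<And>a. G m a j = column_comp \<theta> ks a"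
    using subst_letter_column[OF ks(1), of \<theta>] by (auto simp: m_def)
  \<comment> \<open>Since \<open>r ^ q\<close> exceeds q, the window of length 2 L + 1 fits inside
    the image theta^q of one letter. The phase i below puts its left end -L at the start of block
    j.\<close>
  define q where "q = 2 * L + 1"
  define R where "R = int r ^ q"
  have qR: "int (2 * L + 1) < R"
    using rpow_ge[of q] unfolding R_def q_def by (metis of_nat_less_iff of_nat_power)
  define i where "i = int L + int j * R"
  define g where "g a = map (\<lambda>t. G q a (nat (t + int L))) [- int L..int L]" for a
  define W where "W = g ` range (column_comp \<theta> ks)"
  have "map x [- int L..int L] \<in> W" if x: "shift_pow (- i) x \<in> Y (q + m)" for x
  proof -
    obtain y where y: "y \<in> X" "shift_pow (- i) x = \<Theta> (q + m) y" using x by blast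
    have xt: "x t = \<Theta> (q + m) y (t + i)" for t
      using arg_cong[OF y(2), of "\<lambda>f. f (t + i)"] by simp
    have jm: "int j < int r ^ m" using j(1) by (metis of_nat_less_iff of_nat_power)
    have col: "\<Theta> m y (int j) = column_comp \<theta> ks (y 0)"
      using jm j(2)[of "y 0"] by (simp add: \<Theta>_apply div_pos_pos_trivial)
    have "x t = G q (column_comp \<theta> ks (y 0)) (nat (t + int L))" if t: "- int L \<le> t" "t \<le> int L" for t
    proof -
      have tL: "0 \<le> t + int L" "t + int L < R" using t qR by auto
      have e: "t + i = (t + int L) + int j * R" by (simp add: i_def)
      have d: "(t + i) div R = int j" "(t + i) mod R = t + int L"
        unfolding e using tL by (simp_all add: div_pos_pos_trivial)
      have "x t = \<Theta> q (\<Theta> m y) (t + i)" unfolding xt by (simp add: funpow_add)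
      also have "\<dots> = G q (\<Theta> m y (int j)) (nat (t + int L))"
        unfolding \<Theta>_apply[of q] R_def[symmetric] d ..
      finally show ?thesis unfolding col .
    qed
    then have "map x [- int L..int L] = g (column_comp \<theta> ks (y 0))" by (simp add: g_def)
    then show ?thesis by (simp add: W_def)
  qed
  moreover have "card W \<le> column_number r \<theta>" "finite W"
    unfolding W_def ks(2)[symmetric] by (simp_all add: card_image_le)
  ultimately show ?thesis by blast
qed

lemma subst_inv_\<Theta>: "subst_inv r \<theta> n (\<Theta> n x) = x" if "x \<in> X"
  unfolding subst_inv_def using that by (intro inv_into_f_f inj_onI) (auto dest: \<Theta>_inj)

text \<open>If \<open>\<theta>\<^sup>N\<close> semiconjugates \<open>\<Phi>\<close> to a translate of \<open>\<Psi>\<close>, then the window of \<open>\<Phi>\<close> is that of \<open>\<Psi>\<close>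
  divided by \<open>r\<^sup>N\<close>.\<close>

lemma window_transfer:
  assumes eq: "\<And>x. x \<in> X \<Longrightarrow> \<Theta> N (\<Phi> x) = shift_pow (- K) (\<Psi> (\<Theta> N x))"
    and R: "radius_rule X \<Psi> R"
    and a: "a * int r ^ N \<le> - K - int R" and b: "int r ^ N - K + int R \<le> (b + 1) * int r ^ N"
    and x: "x \<in> X" and y: "y \<in> X"
    and win: "\<And>u. a \<le> u \<Longrightarrow> u \<le> b \<Longrightarrow> x (i + u) = y (j + u)"
  shows "\<Phi> x i = \<Phi> y j"
proof (rule \<Theta>_local_inj[of N])
  define Q where "Q = int r ^ N"
  have Q: "Q > 0" by (simp add: Q_def)
  fix t assume t: "0 \<le> t" "t < int r ^ N"
  have "\<Psi> (\<Theta> N x) (i * Q + t - K) = \<Psi> (\<Theta> N y) (j * Q + t - K)"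
  proof -
    have "\<Theta> N x (i * Q + t - K + u) = \<Theta> N y (j * Q + t - K + u)" if u: "\<bar>u\<bar> \<le> int R" for u
    proof -
      \<comment> \<open>The positions that the rule of \<Psi> reads, relative to the block. The
        bounds on a and b place them in the blocks a to b; the translation by -a blocks makes them
        nonnegative for \<open>int_div_bounds\<close>.\<close>
      define s where "s = t - K + u"
      have s: "0 \<le> s + (- a) * Q" "s + (- a) * Q < (b + 1 - a) * Q"
        using a b t u by (simp_all add: s_def algebra_simps flip: Q_def)
      have "(s + (- a) * Q) div Q = - a + s div Q" using Q by (intro div_mult_self1) simp
      then have "a \<le> s div Q" "s div Q \<le> b" using int_div_bounds[OF s Q] by linarith+
      then have w: "x (i + s div Q) = y (j + s div Q)" by (rule win)
      have e: "i * Q + t - K + u = s + i * Q" "j * Q + t - K + u = s + j * Q" by (simp_all add: s_def)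
      show ?thesis unfolding e \<Theta>_apply Q_def[symmetric] using w Q by (simp add: add.commute)
    qed
    then show ?thesis using R \<Theta>_in_shift[OF x] \<Theta>_in_shift[OF y] unfolding radius_rule_def by blast
  qed
  then show "\<Theta> N (\<Phi> x) (i * int r ^ N + t) = \<Theta> N (\<Phi> y) (j * int r ^ N + t)"
    by (simp add: eq x y Q_def)
qed

text \<open>\<open>subst_inv\<close> gives an arbitrary value off \<open>Y p\<close>. That its
  argument lies there is part of \<open>renorm_phase\<close>.\<close>

definition renorm :: "nat \<Rightarrow> int \<Rightarrow> ((int \<Rightarrow> 'a) \<Rightarrow> int \<Rightarrow> 'a) \<Rightarrow> (int \<Rightarrow> 'a) \<Rightarrow> int \<Rightarrow> 'a" where
  "renorm p k \<Phi> x = subst_inv r \<theta> p (shift_pow (- k) (\<Phi> (\<Theta> p x)))"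

text \<open>The rotation number stated through phases, so that iterates of \<open>renorm\<close> can
  be handled without evaluating \<open>kappa\<close> on them.\<close>

definition rotates :: "((int \<Rightarrow> 'a) \<Rightarrow> int \<Rightarrow> 'a) \<Rightarrow> (nat \<Rightarrow> nat) \<Rightarrow> bool" where
  "rotates \<Phi> z \<longleftrightarrow> endo \<Phi> \<and> (\<forall>n. \<forall>x\<in>Y n. shift_pow (- int (radic_res r z n)) (\<Phi> x) \<in> Y n)"

section \<open>Renormalization at a fixed rotation number z = k / (1 - r^p), given by its
  congruences\<close>

context
  fixes p :: nat and k :: int and z :: "nat \<Rightarrow> nat"
  assumes z: "z \<in> radic_integers r"
    and quot: "\<And>n. int r ^ n dvd int (radic_res r z n) * (1 - int r ^ p) - k"
begin

text \<open>Let b and a be the residues of z modulo r^(p+n) and r^n. By \<open>quot\<close>, b - k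
  is congruent to b r^p, hence to a r^p, modulo r^(p+n). So sigma^(-k) \<Phi> theta^p x has phase a
  r^p with respect to \<open>Y (p + n)\<close>, which after removing theta^p is the phase a with
  respect to \<open>Y n\<close>.\<close>

lemma renorm_phase:
  assumes "rotates \<Phi> z" "x \<in> Y n"
  shows "shift_pow (- int (radic_res r z n)) (renorm p k \<Phi> x) \<in> Y n"
    and "\<Theta> p (renorm p k \<Phi> x) = shift_pow (- k) (\<Phi> (\<Theta> p x))"
proof -
  define a where "a = int (radic_res r z n)"
  define b where "b = int (radic_res r z (p + n))"
  define w where "w = shift_pow (- k) (\<Phi> (\<Theta> p x))"
  have "shift_pow (- b) (\<Phi> (\<Theta> p x)) \<in> Y (p + n)"
    using assms \<Theta>_in_Y unfolding rotates_def b_def by blast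
  then have w: "shift_pow (- (b - k)) w \<in> Y (p + n)" by (simp add: w_def shift_pow_add)
  have "b mod int r ^ n = a"
    using radic_res_mod[OF z, of n p] unfolding a_def b_def by (metis add.commute of_nat_mod of_nat_power)
  then have "int r ^ n dvd b - a" by (metis dvd_minus_mod)
  then have "int r ^ p * int r ^ n dvd int r ^ p * (b - a)" by simp
  then have "int r ^ (p + n) dvd int r ^ p * (b - a) + (b * (1 - int r ^ p) - k)"
    using quot[of "p + n"] unfolding b_def[symmetric] by (simp add: power_add)
  moreover have "int r ^ p * (b - a) + (b * (1 - int r ^ p) - k) = b - k - a * int r ^ p"
    by (simp add: algebra_simps)
  ultimately have "shift_pow (- (a * int r ^ p)) w \<in> Y (p + n)"
    using phase_cong[OF w] by simp
  then obtain v where v: "v \<in> Y n" "shift_pow (- (a * int r ^ p)) w = \<Theta> p v"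
    using Y_add[of p n] by auto
  have "w = shift_pow (a * int r ^ p) (shift_pow (- (a * int r ^ p)) w)" by (simp add: shift_pow_add)
  also have "\<dots> = \<Theta> p (shift_pow a v)" unfolding v(2) \<Theta>_shift ..
  finally have w_eq: "w = \<Theta> p (shift_pow a v)" .
  have vX: "shift_pow a v \<in> X" using Y_subset[OF v(1)] by simp
  have ren: "renorm p k \<Phi> x = shift_pow a v"
    unfolding renorm_def w_def[symmetric] w_eq using vX by (rule subst_inv_\<Theta>)
  show "shift_pow (- int (radic_res r z n)) (renorm p k \<Phi> x) \<in> Y n"
    unfolding ren a_def[symmetric] using v(1) by (simp add: shift_pow_add)
  show "\<Theta> p (renorm p k \<Phi> x) = shift_pow (- k) (\<Phi> (\<Theta> p x))"
    unfolding ren w_def[symmetric] by (rule w_eq[symmetric])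
qed

lemma renorm_conj: "\<Theta> p (renorm p k \<Phi> x) = shift_pow (- k) (\<Phi> (\<Theta> p x))"
  if "rotates \<Phi> z" "x \<in> X"
  using renorm_phase(2)[OF that(1), of x 0] that(2) by simp

lemma rotates_renorm:
  assumes rot: "rotates \<Phi> z"
  shows "rotates (renorm p k \<Phi>) z"
proof -
  obtain R where R: "radius_rule X \<Phi> R" using rot by (auto simp: rotates_def endo_def)
  have "renorm p k \<Phi> x \<in> X" if "x \<in> X" for x
    using renorm_phase(1)[OF rot, of x 0] that by (simp add: radic_res_def)
  moreover have "radius_rule X (renorm p k \<Phi>) (nat \<bar>k\<bar> + R)"
    unfolding radius_rule_def
  proof (intro ballI allI impI)
    fix x y i j assume x: "x \<in> X" and y: "y \<in> X" and
      eq: "\<forall>t. \<bar>t\<bar> \<le> int (nat \<bar>k\<bar> + R) \<longrightarrow> x (i + t) = y (j + t)"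
    define b where "b = \<bar>k\<bar> + int R"
    have "1 \<le> int r ^ p" using rpow_pos[of p] by linarith
    then have b: "b * 1 \<le> b * int r ^ p" unfolding b_def by (intro mult_left_mono) auto
    show "renorm p k \<Phi> x i = renorm p k \<Phi> y j"
    proof (rule window_transfer[OF renorm_conj[OF rot] R _ _ x y])
      have "k + int R \<le> b" "- k + int R \<le> b" by (simp_all add: b_def)
      moreover have "- b * int r ^ p = - (b * int r ^ p)" "(b + 1) * int r ^ p = b * int r ^ p + int r ^ p"
        by (simp_all add: distrib_right)
      ultimately show "- b * int r ^ p \<le> - k - int R" "int r ^ p - k + int R \<le> (b + 1) * int r ^ p"
        using b by linarith+
      show "x (i + u) = y (j + u)" if "- b \<le> u" "u \<le> b" for u
        using eq that by (simp add: b_def abs_le_iff)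
    qed
  qed
  ultimately have "endo (renorm p k \<Phi>)" by (auto simp: endo_def)
  then show ?thesis using renorm_phase(1)[OF rot] by (simp add: rotates_def)
qed

lemma rotates_iter: "rotates \<Phi> z \<Longrightarrow> rotates ((renorm p k ^^ j) \<Phi>) z"
  by (induction j) (auto intro: rotates_renorm)

text \<open>The geometric sum arises because sigma^(-k), moved past theta^(p j), becomes the shift
  by -k r^(p j).\<close>

lemma renorm_iter_conj:
  assumes "rotates \<Phi> z" "x \<in> X"
  shows "\<Theta> (p * j) ((renorm p k ^^ j) \<Phi> x) =
    shift_pow (- (k * (\<Sum>i<j. int r ^ (i * p)))) (\<Phi> (\<Theta> (p * j) x))"
  using assms(2)
proof (induction j arbitrary: x)
  case (Suc j)
  let ?\<Psi> = "(renorm p k ^^ j) \<Phi>"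
  have split: "\<Theta> (p * Suc j) y = \<Theta> (p * j) (\<Theta> p y)" for y
    using funpow_add[of "p * j" p "subst_bi r \<theta>"] by (simp add: add.commute)
  have "\<Theta> (p * Suc j) ((renorm p k ^^ Suc j) \<Phi> x) = \<Theta> (p * j) (\<Theta> p (renorm p k ?\<Psi> x))"
    unfolding split by simp
  also have "\<dots> = \<Theta> (p * j) (shift_pow (- k) (?\<Psi> (\<Theta> p x)))"
    using renorm_conj[OF rotates_iter[OF assms(1)] Suc.prems] by simp
  also have "\<dots> = shift_pow (- k * int r ^ (p * j)) (\<Theta> (p * j) (?\<Psi> (\<Theta> p x)))"
    by (rule \<Theta>_shift)
  also have "\<dots> = shift_pow (- k * int r ^ (p * j) + - (k * (\<Sum>i<j. int r ^ (i * p))))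
      (\<Phi> (\<Theta> (p * j) (\<Theta> p x)))"
    unfolding Suc.IH[OF \<Theta>_in_shift[OF Suc.prems]] shift_pow_add ..
  also have "- k * int r ^ (p * j) + - (k * (\<Sum>i<j. int r ^ (i * p))) =
      - (k * (\<Sum>i<Suc j. int r ^ (i * p)))"
    by (simp add: algebra_simps)
  finally show ?case unfolding split .
qed simp

text \<open>Renormalization is injective on maps: it determines \<Phi> on theta^p(X), and every
  point is a translate of such a point.\<close>

lemma renorm_cancel:
  assumes "rotates \<Phi> z" "rotates \<Psi> z" "\<And>x. x \<in> X \<Longrightarrow> renorm p k \<Phi> x = renorm p k \<Psi> x" "x \<in> X"
  shows "\<Phi> x = \<Psi> x"
proof -
  obtain i y where y: "y \<in> X" "x = shift_pow (int i) (\<Theta> p y)" using desubstitute[OF assms(4)] by blast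
  have "shift_pow (- k) (\<Phi> (\<Theta> p y)) = shift_pow (- k) (\<Psi> (\<Theta> p y))"
    using renorm_conj[OF assms(1) y(1)] renorm_conj[OF assms(2) y(1)] assms(3)[OF y(1)] by simp
  then have "shift_pow k (shift_pow (- k) (\<Phi> (\<Theta> p y))) = shift_pow k (shift_pow (- k) (\<Psi> (\<Theta> p y)))"
    by simp
  then have "\<Phi> (\<Theta> p y) = \<Psi> (\<Theta> p y)" by (simp add: shift_pow_add)
  moreover have "endo \<Phi>" "endo \<Psi>" using assms(1,2) by (simp_all add: rotates_def)
  ultimately show ?thesis using \<Theta>_in_shift[OF y(1)] by (simp add: y(2) endo_shift)
qed

text \<open>Maps are total functions that are compared only on X, so this congruence takes the place
  of rewriting with an equality of maps.\<close>

lemma renorm_cong: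
  assumes "\<And>x. x \<in> X \<Longrightarrow> \<Phi> x = \<Psi> x" "x \<in> X"
  shows "(renorm p k ^^ j) \<Phi> x = (renorm p k ^^ j) \<Psi> x"
  using assms(2)
proof (induction j arbitrary: x)
  case (Suc j)
  then show ?case using \<Theta>_in_shift by (simp add: renorm_def)
qed (use assms(1) in simp)

lemma radius_rule_common: "\<exists>R. \<forall>j\<le>m :: nat. radius_rule X (F j) R"
  if "\<And>j. j \<le> m \<Longrightarrow> endo (F j)"
proof -
  have "\<forall>j\<in>{..m}. \<exists>R. radius_rule X (F j) R" using that by (simp add: endo_def)
  then obtain R where R: "\<And>j. j \<le> m \<Longrightarrow> radius_rule X (F j) (R j)" by (metis atMost_iff)
  have "radius_rule X (F j) (\<Sum>j\<le>m. R j)" if j: "j \<le> m" for j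
    unfolding radius_rule_def
  proof (intro ballI allI impI)
    fix x y i i' assume x: "x \<in> X" and y: "y \<in> X" and
      eq: "\<forall>t. \<bar>t\<bar> \<le> int (\<Sum>j\<le>m. R j) \<longrightarrow> x (i + t) = y (i' + t)"
    have "R j \<le> (\<Sum>j\<le>m. R j)" using j by (intro member_le_sum) auto
    then have "\<bar>t\<bar> \<le> int (\<Sum>j\<le>m. R j)" if "\<bar>t\<bar> \<le> int (R j)" for t using that by linarith
    then have "\<forall>t. \<bar>t\<bar> \<le> int (R j) \<longrightarrow> x (i + t) = y (i' + t)" using eq by blast
    then show "F j x i = F j y i'" using R[OF j] x y unfolding radius_rule_def by blast
  qed
  then show ?thesis by blast
qed

text \<open>All iterates rotate by \<open>z\<close>. On a suitable window the images of a point \<open>x\<close> under maps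
  with the same rotation take at most \<open>c\<close> values, so two of the first \<open>c + 1\<close> iterates
  agree there; a window containing all short words then makes these two maps equal.\<close>

lemma renorm_collision:
  assumes rot: "rotates \<Phi> z"
  shows "\<exists>i j. i < j \<and> j \<le> column_number r \<theta> \<and>
    (\<forall>x\<in>X. (renorm p k ^^ i) \<Phi> x = (renorm p k ^^ j) \<Phi> x)"
proof -
  define c where "c = column_number r \<theta>"
  define F where "F j = (renorm p k ^^ j) \<Phi>" for j
  have F: "rotates (F j) z" for j unfolding F_def by (rule rotates_iter[OF rot])
  obtain R where R: "\<And>j. j \<le> c \<Longrightarrow> radius_rule X (F j) R"
    using radius_rule_common[of c F] F unfolding rotates_def by blast
  obtain M where M: "\<And>x y i b. x \<in> X \<Longrightarrow> y \<in> X \<Longrightarrow> \<exists>s. b \<le> s \<and> s + int (2 * R + 1) \<le> b + int M \<and>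
     (\<forall>t. 0 \<le> t \<and> t < int (2 * R + 1) \<longrightarrow> y (i + t) = x (s + t))"
    using shift_recurrent[of "2 * R + 1"] by blast
  obtain n i W where W: "finite W" "card W \<le> c"
      "\<And>x. shift_pow (- i) x \<in> Y n \<Longrightarrow> map x [- int M..int M] \<in> W"
    using few_windows[of M] unfolding c_def by blast
  obtain y where y: "y \<in> Y n" using Y_nonempty by blast
  \<comment> \<open>All maps F j move y, a point of phase 0, to the phase given by z. The
    translation corrects this common phase to i, where \<open>few_windows\<close> applies to every F
    j x at once.\<close>
  define x where "x = shift_pow (i - int (radic_res r z n)) y"
  have x: "x \<in> X" unfolding x_def using Y_subset[OF y] by simp
  have "map (F j x) [- int M..int M] \<in> W" for j
  proof (rule W(3))
    have "endo (F j)" using F by (simp add: rotates_def)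
    then have "F j x = shift_pow (i - int (radic_res r z n)) (F j y)"
      unfolding x_def using Y_subset[OF y] by (rule endo_shift)
    then have "shift_pow (- i) (F j x) = shift_pow (- int (radic_res r z n)) (F j y)"
      by (simp add: shift_pow_add)
    then show "shift_pow (- i) (F j x) \<in> Y n" using F y unfolding rotates_def by metis
  qed
  then have "(\<lambda>j. map (F j x) [- int M..int M]) ` {..c} \<subseteq> W" by blast
  then have "\<not> inj_on (\<lambda>j. map (F j x) [- int M..int M]) {..c}"
    using W(1,2) card_inj_on_le[of "\<lambda>j. map (F j x) [- int M..int M]" "{..c}" W] by auto
  then obtain a b where ab: "a < b" "b \<le> c" "map (F a x) [- int M..int M] = map (F b x) [- int M..int M]"
    unfolding inj_on_def by (metis atMost_iff linorder_neqE_nat)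
  have agree: "F a x t = F b x t" if "- int M \<le> t" "t \<le> int M" for t
    using ab(3) that by (simp add: map_eq_conv)
  have "F a y' t = F b y' t" if y': "y' \<in> X" for y' t
  proof -
    \<comment> \<open>A copy of the radius-R neighbourhood of t in y' is found in x between -M and
      0, so its centre s + R lies in the window where F a x and F b x agree.\<close>
    obtain s where s: "- int M \<le> s" "s + int (2 * R + 1) \<le> - int M + int M"
        "\<And>u. 0 \<le> u \<Longrightarrow> u < int (2 * R + 1) \<Longrightarrow> y' (t - int R + u) = x (s + u)"
      using M[OF x y', of "- int M" "t - int R"] by blast
    have eq: "\<forall>u. \<bar>u\<bar> \<le> int R \<longrightarrow> y' (t + u) = x (s + int R + u)"
    proof (intro allI impI)
      fix u assume "\<bar>u\<bar> \<le> int R"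
      then show "y' (t + u) = x (s + int R + u)" using s(3)[of "u + int R"] by (simp add: algebra_simps)
    qed
    have loc: "F j y' t = F j x (s + int R)" if "j \<le> c" for j
      using R[OF that] y' x eq unfolding radius_rule_def by blast
    show ?thesis using loc[of a] loc[of b] ab agree[of "s + int R"] s(1,2) by simp
  qed
  then show ?thesis using ab(1,2) unfolding F_def c_def by blast
qed

text \<open>Cancelling the first i iterates from a collision leaves a pure period j - i of at most
  c, which divides c!. The factor m gives access to arbitrarily deep iterates.\<close>

lemma renorm_periodic:
  assumes rot: "rotates \<Phi> z" and x: "x \<in> X"
  shows "(renorm p k ^^ (fact (column_number r \<theta>) * m)) \<Phi> x = \<Phi> x"
proof -
  obtain i j where ij: "i < j" "j \<le> column_number r \<theta>"
    and eq: "\<And>x. x \<in> X \<Longrightarrow> (renorm p k ^^ i) \<Phi> x = (renorm p k ^^ j) \<Phi> x"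
    using renorm_collision[OF rot] by blast
  define d where "d = j - i"
  have cancel: "\<forall>x\<in>X. (renorm p k ^^ i) \<Phi> x = (renorm p k ^^ (i + d)) \<Phi> x \<Longrightarrow>
      \<forall>x\<in>X. \<Phi> x = (renorm p k ^^ d) \<Phi> x" for i
  proof (induction i)
    case (Suc i)
    have "(renorm p k ^^ i) \<Phi> x = (renorm p k ^^ (i + d)) \<Phi> x" if "x \<in> X" for x
    proof (rule renorm_cancel[OF rotates_iter[OF rot] rotates_iter[OF rot] _ that])
      show "renorm p k ((renorm p k ^^ i) \<Phi>) x = renorm p k ((renorm p k ^^ (i + d)) \<Phi>) x" if "x \<in> X" for x
        using Suc.prems that by simp
    qed
    then show ?case using Suc.IH by blast
  qed simp
  then have per: "\<Phi> x = (renorm p k ^^ d) \<Phi> x" if "x \<in> X" for x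
    using cancel[of i] eq that ij(1) unfolding d_def by simp
  have mult: "(renorm p k ^^ (d * n)) \<Phi> x = \<Phi> x" if "x \<in> X" for n x
    using that
  proof (induction n arbitrary: x)
    case (Suc n)
    have "(renorm p k ^^ (d * Suc n)) \<Phi> x = (renorm p k ^^ (d * n)) ((renorm p k ^^ d) \<Phi>) x"
      using funpow_add[of "d * n" d "renorm p k"] by (simp add: add.commute)
    also have "\<dots> = (renorm p k ^^ (d * n)) \<Phi> x" using Suc.prems per by (intro renorm_cong) auto
    finally show ?case using Suc by simp
  qed simp
  have "d dvd fact (column_number r \<theta>)" using ij by (intro dvd_fact) (auto simp: d_def)
  then obtain e where "fact (column_number r \<theta>) = d * e" by (auto simp: dvd_def)
  then show ?thesis using mult[OF x, of "e * m"] by (simp add: mult.assoc)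
qed

text \<open>The value m = 1 yields the conjugation formula; m equal to a radius of \<Phi> yields the
  bounds on the radii.\<close>

lemma renorm_fixed:
  assumes "rotates \<Phi> z" "x \<in> X"
  shows "\<Theta> (p * (fact (column_number r \<theta>) * m)) (\<Phi> x) =
    shift_pow (- (k * (\<Sum>i<fact (column_number r \<theta>) * m. int r ^ (i * p))))
      (\<Phi> (\<Theta> (p * (fact (column_number r \<theta>) * m)) x))"
  using renorm_iter_conj[OF assms, of "fact (column_number r \<theta>) * m"] renorm_periodic[OF assms, of m]
  by simp

text \<open>Membership in \<open>Y N\<close> is recorded too, since it certifies that
  \<open>subst_inv\<close> is applied within its proper domain.\<close>

lemma renorm_formula:
  assumes rot: "rotates \<Phi> z" and x: "x \<in> X"
  defines "N \<equiv> fact (column_number r \<theta>) * p"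
    and "w \<equiv> shift_pow (- (k * (\<Sum>j<fact (column_number r \<theta>). int r ^ (j * p))))
      (\<Phi> (\<Theta> (fact (column_number r \<theta>) * p) x))"
  shows "w \<in> Y N" "subst_inv r \<theta> N w = \<Phi> x"
proof -
  have "\<Phi> x \<in> X" using rot x by (simp add: rotates_def endo_def)
  moreover have "\<Theta> N (\<Phi> x) = w"
    using renorm_fixed[OF rot x, of 1] unfolding N_def w_def by (simp add: mult.commute)
  ultimately show "w \<in> Y N" "subst_inv r \<theta> N w = \<Phi> x" using subst_inv_\<Theta>[of "\<Phi> x" N] by auto
qed

section \<open>Bounds for the radii\<close>

lemma geometric_bounds:
  "int J \<le> (\<Sum>i<J. int r ^ (i * p))"
  "(int r ^ p - 1) * (\<Sum>i<J. int r ^ (i * p)) = int r ^ (p * J) - 1"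
proof -
  have "int r ^ n \<ge> 1" for n using rpow_pos[of n] by linarith
  then have "(\<Sum>i<J. 1) \<le> (\<Sum>i<J. int r ^ (i * p))" by (intro sum_mono) simp
  then show "int J \<le> (\<Sum>i<J. int r ^ (i * p))" by simp
  show "(int r ^ p - 1) * (\<Sum>i<J. int r ^ (i * p)) = int r ^ (p * J) - 1"
    by (induction J) (auto simp: algebra_simps power_add)
qed

text \<open>With S the geometric sum, the total shift is k S, and 0 < k < r^p - 1 gives S <= k S and
  (k + 1) S <= r^(p J) - 1. Once S is at least R, the positions read by the rule stay inside the
  blocks -1 and 0.\<close>

lemma block_map_1_0:
  assumes rot: "rotates \<Phi> z" and k: "0 < k" "k < int r ^ p - 1"
  shows "block_map X \<Phi> 1 0"
proof (rule block_mapI)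
  fix x y i j assume x: "x \<in> X" and y: "y \<in> X" and
    win: "\<And>u. - int 1 \<le> u \<Longrightarrow> u \<le> int 0 \<Longrightarrow> x (i + u) = y (j + u)"
  obtain R where R: "radius_rule X \<Phi> R" using rot by (auto simp: rotates_def endo_def)
  \<comment> \<open>A multiple of c! that is at least R, so that S, being at least J, is at least R
    as well.\<close>
  define J where "J = fact (column_number r \<theta>) * R"
  define S where "S = (\<Sum>i<J. int r ^ (i * p))"
  have "R \<le> J" by (simp add: J_def)
  then have RS: "int R \<le> S" using geometric_bounds(1)[of J] unfolding S_def by linarith
  then have "1 * S \<le> k * S" "(k + 1) * S \<le> (int r ^ p - 1) * S"
    using k by (intro mult_right_mono; simp)+
  then have K: "int R \<le> k * S" "k * S + int R \<le> int r ^ (p * J)"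
    using RS geometric_bounds(2)[of J] unfolding S_def[symmetric] by (simp_all add: distrib_right)
  show "\<Phi> x i = \<Phi> y j"
  proof (rule window_transfer[OF _ R _ _ x y])
    show "\<Theta> (p * J) (\<Phi> x) = shift_pow (- (k * S)) (\<Phi> (\<Theta> (p * J) x))" if "x \<in> X" for x
      using renorm_fixed[OF rot that, of R] unfolding J_def S_def .
    show "- 1 * int r ^ (p * J) \<le> - (k * S) - int R" using K by simp
    show "int r ^ (p * J) - k * S + int R \<le> (0 + 1) * int r ^ (p * J)" using K by simp
    show "x (i + u) = y (j + u)" if "- 1 \<le> u" "u \<le> 0" for u using win that by simp
  qed
qed

text \<open>Without a shift the positions read run from -R to r^J - 1 + R, which stays within the
  blocks -1, 0 and 1 as soon as R is at most r^J.\<close>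

lemma block_map_1_1:
  assumes rot: "rotates \<Phi> z" and "k = 0" "p = 1"
  shows "block_map X \<Phi> 1 1"
proof (rule block_mapI)
  fix x y i j assume x: "x \<in> X" and y: "y \<in> X" and
    win: "\<And>u. - int 1 \<le> u \<Longrightarrow> u \<le> int 1 \<Longrightarrow> x (i + u) = y (j + u)"
  obtain R where R: "radius_rule X \<Phi> R" using rot by (auto simp: rotates_def endo_def)
  define J where "J = fact (column_number r \<theta>) * R"
  have "R \<le> J" by (simp add: J_def)
  then have "R \<le> r ^ J" using rpow_ge[of J] by linarith
  then have RJ: "int R \<le> int r ^ J" by (metis of_nat_le_iff of_nat_power)
  show "\<Phi> x i = \<Phi> y j"
  proof (rule window_transfer[OF _ R _ _ x y])
    show "\<Theta> J (\<Phi> x) = shift_pow (- 0) (\<Phi> (\<Theta> J x))" if "x \<in> X" for x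
      using renorm_fixed[OF rot that, of R] assms(2,3) unfolding J_def by simp
    show "- 1 * int r ^ J \<le> - 0 - int R" using RJ by simp
    show "int r ^ J - 0 + int R \<le> (1 + 1) * int r ^ J" using RJ by simp
    show "x (i + u) = y (j + u)" if "- 1 \<le> u" "u \<le> 1" for u using win that by simp
  qed
qed

end

end

theorem proposition3p19:
  fixes \<theta> :: "'a::finite \<Rightarrow> 'a list" and r c :: nat
    and \<Phi> :: "(int \<Rightarrow> 'a) \<Rightarrow> int \<Rightarrow> 'a" and X :: "(int \<Rightarrow> 'a) set"
  defines "X \<equiv> subst_shift r \<theta>"
    and "c \<equiv> column_number r \<theta>"
  assumes "substitution r \<theta>"
    and "inj \<theta>"
    and "primitive_subst \<theta>"
    and "height r \<theta> = 1"
    and "infinite X"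
    and "\<Phi> \<in> shift_Aut r \<theta>"
  shows
    "(kappa r \<theta> \<Phi> \<in> radic_integers r - range (radic_of_int r) \<and> radic_periodic (kappa r \<theta> \<Phi>) \<longrightarrow>
        right_radius X \<Phi> = 0 \<and> left_radius X \<Phi> \<le> 1 \<and> block_map X \<Phi> 1 0) \<and>
     (\<forall>(p::nat) (k::int). p \<ge> 1 \<and> 0 < k \<and> k < int r ^ p - 1 \<and>
        radic_is_quotient r (kappa r \<theta> \<Phi>) k (1 - int r ^ p) \<longrightarrow>
        (\<forall>x\<in>X.
           shift_pow (- (k * (\<Sum>j<fact c. int r ^ (j * p)))) (\<Phi> ((subst_bi r \<theta> ^^ (fact c * p)) x))
             \<in> (subst_bi r \<theta> ^^ (fact c * p)) ` X \<and>
           (subst_inv r \<theta> (fact c * p) \<circ> shift_pow (- (k * (\<Sum>j<fact c. int r ^ (j * p)))) \<circ>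
              \<Phi> \<circ> (subst_bi r \<theta> ^^ (fact c * p))) x = \<Phi> x)) \<and>
     (kappa r \<theta> \<Phi> = radic_of_int r 0 \<longrightarrow>
        left_radius X \<Phi> \<le> 1 \<and> right_radius X \<Phi> \<le> 1 \<and> block_map X \<Phi> 1 1 \<and>
        (\<forall>x\<in>X.
           \<Phi> ((subst_bi r \<theta> ^^ fact c) x) \<in> (subst_bi r \<theta> ^^ fact c) ` X \<and>
           (subst_inv r \<theta> (fact c) \<circ> \<Phi> \<circ> (subst_bi r \<theta> ^^ fact c)) x = \<Phi> x))"
proof -
  interpret aperiodic_substitution \<theta> r
    using assms by unfold_locales auto
  define z where "z = kappa r \<theta> \<Phi>"
  have endo: "endo \<Phi>" using assms(8) by (rule endo_of_Aut)
  have z: "z \<in> radic_integers r" unfolding z_def by (rule kappa(1)[OF endo])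
  have rot: "rotates \<Phi> z" unfolding rotates_def z_def using endo kappa(2)[OF endo] by blast
  have "right_radius X \<Phi> = 0 \<and> left_radius X \<Phi> \<le> 1 \<and> block_map X \<Phi> 1 0"
    if notint: "z \<notin> range (radic_of_int r)" and per: "radic_periodic z"
  proof -
    obtain p k where p: "p \<ge> 1" and k: "0 \<le> k" "k < int r ^ p"
      and quot: "\<And>n. int r ^ n dvd int (radic_res r z n) * (1 - int r ^ p) - k"
      and ends: "k = 0 \<Longrightarrow> z \<in> range (radic_of_int r)" "k = int r ^ p - 1 \<Longrightarrow> z \<in> range (radic_of_int r)"
      by (rule radic_periodic_cases[OF z r_ge_2 per]) blast
    \<comment> \<open>The two end values would make the rotation number the integer 0 or -1.\<close>
    have "k \<noteq> 0" "k \<noteq> int r ^ p - 1" using ends notint by blast+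
    then have "0 < k" "k < int r ^ p - 1" using k by linarith+
    then have "block_map X \<Phi> 1 0" unfolding X_def by (rule block_map_1_0[OF z quot rot])
    then show ?thesis using radii_le[of X \<Phi> 1 0] by simp
  qed
  moreover have "\<forall>x\<in>X.
           shift_pow (- (k * (\<Sum>j<fact c. int r ^ (j * p)))) (\<Phi> ((subst_bi r \<theta> ^^ (fact c * p)) x))
             \<in> (subst_bi r \<theta> ^^ (fact c * p)) ` X \<and>
           (subst_inv r \<theta> (fact c * p) \<circ> shift_pow (- (k * (\<Sum>j<fact c. int r ^ (j * p)))) \<circ>
              \<Phi> \<circ> (subst_bi r \<theta> ^^ (fact c * p))) x = \<Phi> x"
    if "radic_is_quotient r z k (1 - int r ^ p)" for p k
  proof -
    have mult: "radic_mult r (radic_of_int r (1 - int r ^ p)) z = radic_of_int r k"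
      using that by (simp add: radic_is_quotient_def)
    have in_Z: "radic_of_int r i \<in> radic_integers r" for i
      unfolding radic_of_int_def by (rule radic_of_residues_in) simp
    \<comment> \<open>The r-adic equation (1 - r^p) z = k is read off modulo every
      \<open>r ^ n\<close>.\<close>
    have quot: "int r ^ n dvd int (radic_res r z n) * (1 - int r ^ p) - k" for n
    proof -
      have "k mod int r ^ n = int (radic_res r (radic_of_int r k) n)"
        by (simp add: radic_res_of_int)
      also have "\<dots> = (int (radic_res r (radic_of_int r (1 - int r ^ p)) n) * int (radic_res r z n)) mod int r ^ n"
        unfolding mult[symmetric] radic_res_mult[OF in_Z z] by (simp add: zmod_int)
      also have "\<dots> = ((1 - int r ^ p) * int (radic_res r z n)) mod int r ^ n"
        by (simp add: radic_res_of_int mod_mult_left_eq)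
      finally show ?thesis by (metis mod_eq_dvd_iff mult.commute)
    qed
    show ?thesis using renorm_formula[OF z quot rot] unfolding X_def c_def by simp
  qed
  moreover have "left_radius X \<Phi> \<le> 1 \<and> right_radius X \<Phi> \<le> 1 \<and> block_map X \<Phi> 1 1 \<and>
        (\<forall>x\<in>X.
           \<Phi> ((subst_bi r \<theta> ^^ fact c) x) \<in> (subst_bi r \<theta> ^^ fact c) ` X \<and>
           (subst_inv r \<theta> (fact c) \<circ> \<Phi> \<circ> (subst_bi r \<theta> ^^ fact c)) x = \<Phi> x)"
    if "z = radic_of_int r 0"
  proof -
    \<comment> \<open>Rotation number 0 is treated as k = 0 with p = 1: the accumulated shift
      vanishes and the exponent c! p becomes c!.\<close>
    have quot: "int r ^ n dvd int (radic_res r z n) * (1 - int r ^ 1) - 0" for n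
      using radic_res_of_int[of r 0 n] by (simp add: that)
    have "block_map X \<Phi> 1 1" unfolding X_def by (rule block_map_1_1[OF z quot rot]) simp_all
    then show ?thesis
      using radii_le[of X \<Phi> 1 1] renorm_formula[OF z quot rot] unfolding X_def c_def by simp
  qed
  ultimately show ?thesis unfolding z_def by blast
qed

end
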